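(* For every $n\in\mathbb{N}$, every $\epsilon\ge 0$, every $\delta_1>0$ and every $\delta_2>0$ with $\epsilon+\delta_1+\delta_2<\frac12$, \[ IL(EQ_n,\epsilon)\ \ge\ \delta_1\Big(2\sqrt{g_3(\epsilon+\delta_1+\delta_2)}\,\sqrt{n}-g_3(\epsilon+\delta_1+\delta_2)-g_2(n,n,\delta_2)-10\Big)-2g_1(2n), \] where $g_1(x)=2\log(x+1)+10$, $g_2(x,y,z)=2\log\!\big(\frac{2(x+y)}{z^2\log e}+1\big)+2$, and $g_3(x)=2(1/2-x)^2\log e$.
   Context: All logarithms are base 2. $EQ_n:\{0,1\}^n\times\{0,1\}^n\to\{0,1\}$ is the equality function, $EQ_n(x,y)=1$ iff $x=y$. Shared-randomness simultaneous message passing (SMP) model: Alice gets $x\in X$, Bob gets $y\in Y$. There are mutually independent random strings $R_A$ (Alice's private), $R_B$ (Bob's private), $R_C$ (referee's private), $R_{AC}$ (shared by Alice and referee), $R_{BC}$ (shared by Bob and referee), with fixed distributions, independent of the inputs; no randomness is shared between Alice and Bob. A protocol $\Pi$ is given by these distributions, finite message sets $M_A,M_B$, and functions $\Pi_A:X\times R_A\times R_{AC}\to M_A$, $\Pi_B:Y\times R_B\times R_{BC}\to M_B$, $\Pi_C:M_A\times M_B\times R_C\times R_{AC}\times R_{BC}\to Z$; Alice and Bob each send one message to the referee, who outputs $\Pi_C(\cdot)$. $\Pi(x,y)$ denotes the output random variable. $\Pi$ computes $f$ with error $\epsilon$ if $\max_{(x,y)}\Pr[\Pi(x,y)\neq f(x,y)]\le\epsilon$.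 Information leakage: for a distribution $\mu$ on $X\times Y$, let $(X,Y)\sim\mu$ be independent of all random strings and $M_A,M_B$ the resulting messages; $IL(\Pi,\mu)=I(XY;M_AM_BR_CR_{AC}R_{BC})$ (mutual information), $IL(\Pi)=\max_\mu IL(\Pi,\mu)$, and $IL(f,\epsilon)=\min IL(\Pi)$ over all shared-randomness SMP protocols $\Pi$ computing $f$ with error at most $\epsilon$. *)

theory Defs
  imports "HOL-Probability.Probability"
begin

text \<open>
  The random strings may follow arbitrary probability distributions, not necessarily discrete
  ones. All five range over one type \<open>'r\<close> and both messages over one type \<open>'m\<close>; the
  \<open>\<sigma>\<close>-algebras on \<open>'r\<close> and the message sets may all differ, so (passing to a sum type if needed)
  this is no restriction.
\<close>

record ('x, 'y, 'z, 'r, 'm) smp_protocol =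
  RA :: "'r measure"
  RB :: "'r measure"
  RC :: "'r measure"
  RAC :: "'r measure"
  RBC :: "'r measure"
  MA :: "'m set"
  MB :: "'m set"
  PA :: "'x \<Rightarrow> 'r \<Rightarrow> 'r \<Rightarrow> 'm"  \<comment> \<open>input, \<open>R\<^sub>A\<close>, \<open>R\<^sub>A\<^sub>C\<close>\<close>
  PB :: "'y \<Rightarrow> 'r \<Rightarrow> 'r \<Rightarrow> 'm"  \<comment> \<open>input, \<open>R\<^sub>B\<close>, \<open>R\<^sub>B\<^sub>C\<close>\<close>
  PC :: "'m \<Rightarrow> 'm \<Rightarrow> 'r \<Rightarrow> 'r \<Rightarrow> 'r \<Rightarrow> 'z"  \<comment> \<open>both messages, \<open>R\<^sub>C\<close>, \<open>R\<^sub>A\<^sub>C\<close>, \<open>R\<^sub>B\<^sub>C\<close>\<close>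

definition smp_protocol_on ::
    "'x set \<Rightarrow> 'y set \<Rightarrow> ('x, 'y, 'z, 'r, 'm) smp_protocol \<Rightarrow> bool" where
  "smp_protocol_on X Y P \<longleftrightarrow>
     prob_space (RA P) \<and> prob_space (RB P) \<and> prob_space (RC P) \<and>
     prob_space (RAC P) \<and> prob_space (RBC P) \<and>
     finite (MA P) \<and> finite (MB P) \<and>
     (\<forall>x\<in>X. (\<lambda>(ra, rac). PA P x ra rac)
        \<in> measurable (RA P \<Otimes>\<^sub>M RAC P) (count_space (MA P))) \<and>
     (\<forall>y\<in>Y. (\<lambda>(rb, rbc). PB P y rb rbc)
        \<in> measurable (RB P \<Otimes>\<^sub>M RBC P) (count_space (MB P))) \<and>
     (\<forall>ma\<in>MA P. \<forall>mb\<in>MB P. (\<lambda>(rc, rac, rbc). PC P ma mb rc rac rbc)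
        \<in> measurable (RC P \<Otimes>\<^sub>M RAC P \<Otimes>\<^sub>M RBC P) (count_space UNIV))"

text \<open>The product measure makes the five random strings mutually independent.\<close>

definition randomness ::
    "('x, 'y, 'z, 'r, 'm) smp_protocol \<Rightarrow> ('r \<times> 'r \<times> 'r \<times> 'r \<times> 'r) measure" where
  "randomness P = RA P \<Otimes>\<^sub>M RB P \<Otimes>\<^sub>M RC P \<Otimes>\<^sub>M RAC P \<Otimes>\<^sub>M RBC P"

definition smp_output ::
    "('x, 'y, 'z, 'r, 'm) smp_protocol \<Rightarrow> 'x \<Rightarrow> 'y \<Rightarrow> 'r \<times> 'r \<times> 'r \<times> 'r \<times> 'r \<Rightarrow> 'z" where
  "smp_output P x y = (\<lambda>(ra, rb, rc, rac, rbc).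
     PC P (PA P x ra rac) (PB P y rb rbc) rc rac rbc)"

definition computes_with_error ::
    "'x set \<Rightarrow> 'y set \<Rightarrow> ('x, 'y, 'z, 'r, 'm) smp_protocol \<Rightarrow> ('x \<Rightarrow> 'y \<Rightarrow> 'z) \<Rightarrow> real \<Rightarrow> bool" where
  "computes_with_error X Y P f \<epsilon> \<longleftrightarrow>
     (\<forall>x\<in>X. \<forall>y\<in>Y.
        measure (randomness P) {r \<in> space (randomness P). smp_output P x y r \<noteq> f x y} \<le> \<epsilon>)"

definition input_distributions :: "'x set \<Rightarrow> 'y set \<Rightarrow> ('x \<times> 'y) measure set" where
  "input_distributions X Y = {\<mu>. prob_space \<mu> \<and> sets \<mu> = Pow (X \<times> Y)}"

definition transcript ::
    "('x, 'y, 'z, 'r, 'm) smp_protocol \<Rightarrow> ('x \<times> 'y) \<times> ('r \<times> 'r \<times> 'r \<times> 'r \<times> 'r)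
       \<Rightarrow> 'm \<times> 'm \<times> 'r \<times> 'r \<times> 'r" where
  "transcript P = (\<lambda>((x, y), (ra, rb, rc, rac, rbc)).
     (PA P x ra rac, PB P y rb rbc, rc, rac, rbc))"

text \<open>
  For finite \<open>X\<close> and \<open>Y\<close>, the integral inside \<^const>\<open>prob_space.mutual_information\<close> always exists
  (the value is at most the entropy of the inputs), so no default value is ever taken.
\<close>

definition information_leakage_dist ::
    "'x set \<Rightarrow> 'y set \<Rightarrow> ('x, 'y, 'z, 'r, 'm) smp_protocol \<Rightarrow> ('x \<times> 'y) measure \<Rightarrow> real" where
  "information_leakage_dist X Y P \<mu> =
     prob_space.mutual_information (\<mu> \<Otimes>\<^sub>M randomness P) 2
       (count_space (X \<times> Y))
       (count_space (MA P) \<Otimes>\<^sub>M count_space (MB P) \<Otimes>\<^sub>M RC P \<Otimes>\<^sub>M RAC P \<Otimes>\<^sub>M RBC P)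
       fst (transcript P)"

text \<open>
  Maximum and minimum are taken as supremum and infimum in \<^typ>\<open>ereal\<close>, so that they exist
  unconditionally and agree with the maximum and minimum whenever those are attained.
\<close>

definition information_leakage ::
    "'x set \<Rightarrow> 'y set \<Rightarrow> ('x, 'y, 'z, 'r, 'm) smp_protocol \<Rightarrow> ereal" where
  "information_leakage X Y P =
     (SUP \<mu>\<in>input_distributions X Y. ereal (information_leakage_dist X Y P \<mu>))"

text \<open>
  HOL cannot take an infimum over all types at once, so the types of random strings and of messages
  are explicit parameters.
\<close>

definition IL ::
    "'r itself \<Rightarrow> 'm itself \<Rightarrow> 'x set \<Rightarrow> 'y set \<Rightarrow> ('x \<Rightarrow> 'y \<Rightarrow> 'z) \<Rightarrow> real \<Rightarrow> ereal" where
  "IL _ _ X Y f \<epsilon> =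
     (INF P\<in>{P :: ('x, 'y, 'z, 'r, 'm) smp_protocol.
               smp_protocol_on X Y P \<and> computes_with_error X Y P f \<epsilon>}.
        information_leakage X Y P)"

definition bitstrings :: "nat \<Rightarrow> bool list set" where
  "bitstrings n = {xs. length xs = n}"

definition EQ_fn :: "bool list \<Rightarrow> bool list \<Rightarrow> bool" where
  "EQ_fn x y \<longleftrightarrow> x = y"

definition g1 :: "real \<Rightarrow> real" where
  "g1 x = 2 * log 2 (x + 1) + 10"

definition g2 :: "real \<Rightarrow> real \<Rightarrow> real \<Rightarrow> real" where
  "g2 x y z = 2 * log 2 (2 * (x + y) / (z\<^sup>2 * log 2 (exp 1)) + 1) + 2"

definition g3 :: "real \<Rightarrow> real" where
  "g3 x = 2 * (1 / 2 - x)\<^sup>2 * log 2 (exp 1)"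

end

theory Submission
  imports Defs
begin

text \<open>
  Take both inputs uniform and independent, with leakage \<open>L\<close> in nats. It is the mean over \<open>x\<close> of
  the sum of the relative entropies of Alice's and of Bob's message on input \<open>x\<close> to the message on a random
  input, so for at least half of the inputs both are at most \<open>D = 2 L\<close>; let \<open>G\<close> be the set of these.
  Suppose the referee sees \<open>t\<close> independent copies of Alice's message on \<open>x\<close>, and guesses the \<open>y\<close> for
  which the average acceptance probability against Bob's message on \<open>y\<close> exceeds \<open>1/2\<close>. By the
  Donsker--Varadhan inequality and Hoeffding's lemma, \<open>t\<close> of order \<open>D / (1/2 - \<epsilon>)\<^sup>2\<close> copies make all
  these averages accurate simultaneously for \<open>y \<in> G\<close> (a PAC-Bayes version of the Babai--Kimmel
  sampling argument), so that \<open>x \<in> G\<close> is decoded with probability at least \<open>1/2\<close>. On the other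
  hand \<open>t\<close> copies carry at most \<open>t D\<close> nats, so \<open>t D\<close> is at least of order \<open>ln (card G)\<close>, that is
  of order \<open>n\<close>, and \<open>D\<close> is at least of order \<open>(1/2 - \<epsilon>) sqrt n\<close>. Since \<open>\<delta>\<^sub>1\<close> times the factor \<open>1/2 - \<epsilon> - \<delta>\<^sub>1\<close>
  is at most \<open>(1/2 - \<epsilon>)\<^sup>2 / 4\<close>, the constants lost on the way are affordable.
\<close>

section \<open>Relative entropy and exponential moments\<close>

text \<open>The obstacle is the number of copies. A union bound over all \<open>y\<close> would need
  \<open>t\<close> of order \<open>n\<close> divided by the squared margin, and then
  \<open>n\<close> at most of order \<open>t * D\<close> bounds \<open>D\<close> below only by a
  constant times that squared margin. Changing measure costs \<open>D\<close> instead of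
  \<open>n\<close>, which makes \<open>t * D\<close> quadratic in \<open>D\<close>; this is the
  origin of the square root of \<open>n\<close>. Acceptance is at least
  \<open>1 - \<epsilon>\<close> for \<open>y = x\<close> and at most \<open>\<epsilon>\<close>
  otherwise, so the threshold \<open>1/2\<close> leaves the margin \<open>1/2 - \<epsilon>\<close>
  on both sides. Only Alice's message is copied. Bob's is never sampled: it enters through the
  weights in the averages. Hence Bob's relative entropy determines \<open>t\<close>, and Alice's is
  the one multiplied by \<open>t\<close>. The inequality of Donsker and Varadhan serves twice, for
  the uniform deviation bound and, in the place of Fano's inequality, for the final count. Arbitrary
  random strings cause no integrability problem: all densities are taken relative to the law under
  uniform inputs, where each input has weight \<open>1 / card S\<close>, so they are bounded by
  \<open>card S\<close>.\<close>

lemma (in finite_measure) integrable_bounded: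
  fixes f :: "'a \<Rightarrow> real"
  assumes "f \<in> borel_measurable M" "\<And>a. a \<in> space M \<Longrightarrow> \<bar>f a\<bar> \<le> C"
  shows "integrable M f"
  using assms by (intro integrable_const_bound[where B=C]) (auto intro!: AE_I2)

lemma (in prob_space) integrable_weighted:
  fixes h f :: "'a \<Rightarrow> real"
  assumes [measurable]: "h \<in> borel_measurable M" "f \<in> borel_measurable M"
    and h: "\<And>a. a \<in> space M \<Longrightarrow> 0 \<le> h a" "\<And>a. a \<in> space M \<Longrightarrow> h a \<le> K"
    and f: "\<And>a. a \<in> space M \<Longrightarrow> \<bar>f a\<bar> \<le> C"
  shows "integrable M (\<lambda>a. h a * f a)"
proof (rule integrable_bounded[where C="K * C"])
  fix a assume a: "a \<in> space M"
  show "\<bar>h a * f a\<bar> \<le> K * C"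
    unfolding abs_mult using h[OF a] f[OF a] by (intro mult_mono) auto
qed measurable

text \<open>Crude on purpose: boundedness is all that integrability of \<open>h * ln h\<close>
  requires. The upper bound comes from \<open>ln x \<le> x - 1\<close>, the lower one from the same
  inequality at \<open>1/x\<close>.\<close>

lemma abs_times_ln_le:
  fixes x K :: real
  assumes "0 \<le> x" "x \<le> K"
  shows "\<bar>x * ln x\<bar> \<le> 1 + K * K"
proof (cases "x = 0")
  case False
  with assms have x: "x > 0" by simp
  have "x * ln x \<le> x * x"
    using x ln_le_minus_one[of x] by (intro mult_left_mono) auto
  also have "\<dots> \<le> K * K" using assms by (intro mult_mono) auto
  finally have 1: "x * ln x \<le> 1 + K * K" by simp
  have "ln (1/x) \<le> 1/x - 1" using x by (intro ln_le_minus_one) auto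
  then have "x * ln (1/x) \<le> x * (1/x - 1)" using x by (intro mult_left_mono) auto
  then have "- (x * ln x) \<le> 1 - x" using x by (simp add: ln_div right_diff_distrib)
  moreover have "1 - x \<le> 1 + K * K" using x zero_le_square[of K] by linarith
  ultimately have "- (x * ln x) \<le> 1 + K * K" by linarith
  with 1 show ?thesis by (rule abs_leI)
qed auto

lemma (in prob_space) integrable_times_ln:
  fixes h :: "'a \<Rightarrow> real"
  assumes [measurable]: "h \<in> borel_measurable M"
    and "\<And>a. a \<in> space M \<Longrightarrow> 0 \<le> h a" "\<And>a. a \<in> space M \<Longrightarrow> h a \<le> K"
  shows "integrable M (\<lambda>a. h a * ln (h a))"
  by (rule integrable_bounded[where C="1 + K * K"]) (use assms abs_times_ln_le in auto)

text \<open>Convex duality between \<open>h * ln h - h\<close> and \<open>exp\<close>: apply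
  \<open>ln z \<le> z - 1\<close> at \<open>z = exp f / h\<close>. At \<open>h = 0\<close> the
  factor \<open>h\<close> cancels the default value of \<open>ln 0\<close>.\<close>

lemma fenchel_young_exp:
  fixes h f :: real
  assumes "0 \<le> h"
  shows "h * f \<le> h * ln h + exp f - h"
proof (cases "h = 0")
  case False
  with assms have h: "h > 0" by simp
  have "ln (exp f / h) \<le> exp f / h - 1" using h by (intro ln_le_minus_one) auto
  then have "h * ln (exp f / h) \<le> h * (exp f / h - 1)" using h by (intro mult_left_mono) auto
  then show ?thesis using h by (simp add: ln_div right_diff_distrib)
qed auto

text \<open>The integral of \<open>fenchel_young_exp\<close>. The usual variational formula has the
  logarithm of the exponential moment where this one has the moment minus 1. The weaker form is
  linear in \<open>exp f\<close>, so it can later be averaged over samples and over inputs without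
  Jensen's inequality.\<close>

lemma (in prob_space) donsker_varadhan_le:
  fixes h f :: "'a \<Rightarrow> real"
  assumes [measurable]: "h \<in> borel_measurable M" "f \<in> borel_measurable M"
    and h: "\<And>a. a \<in> space M \<Longrightarrow> 0 \<le> h a" "\<And>a. a \<in> space M \<Longrightarrow> h a \<le> K"
    and f: "\<And>a. a \<in> space M \<Longrightarrow> \<bar>f a\<bar> \<le> C"
    and h1: "(\<integral>a. h a \<partial>M) = 1"
  shows "(\<integral>a. h a * f a \<partial>M) \<le> (\<integral>a. h a * ln (h a) \<partial>M) + (\<integral>a. exp (f a) \<partial>M) - 1"
proof -
  have i1: "integrable M (\<lambda>a. h a * ln (h a))" by (rule integrable_times_ln[OF assms(1) h])
  have i2: "integrable M (\<lambda>a. exp (f a))"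
    by (rule integrable_bounded[where C="exp C"]) (use f in \<open>auto simp: abs_le_iff\<close>)
  have i3: "integrable M h"
    by (rule integrable_bounded[where C=K]) (use h in auto)
  have i4: "integrable M (\<lambda>a. h a * f a)"
    by (rule integrable_weighted[where K=K and C=C]) (use h f in auto)
  have "(\<integral>a. h a * f a \<partial>M) \<le> (\<integral>a. h a * ln (h a) + exp (f a) - h a \<partial>M)"
    using i1 i2 i3 i4 h by (intro integral_mono) (auto intro: fenchel_young_exp)
  also have "\<dots> = (\<integral>a. h a * ln (h a) \<partial>M) + (\<integral>a. exp (f a) \<partial>M) - 1"
    using i1 i2 i3 h1 by simp
  finally show ?thesis .
qed

lemma (in prob_space) relative_entropy_nonneg:
  fixes h :: "'a \<Rightarrow> real"
  assumes "h \<in> borel_measurable M"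
    and "\<And>a. a \<in> space M \<Longrightarrow> 0 \<le> h a" "\<And>a. a \<in> space M \<Longrightarrow> h a \<le> K"
    and "(\<integral>a. h a \<partial>M) = 1"
  shows "0 \<le> (\<integral>a. h a * ln (h a) \<partial>M)"
  using donsker_varadhan_le[of h "\<lambda>_. 0" K 0] assms by (simp add: prob_space)

text \<open>Hoeffding's lemma for a variable with values in an interval of length 1, under the law
  with density \<open>h\<close>. Both signs of \<open>l\<close> are covered because deviations in
  both directions must be controlled.\<close>

lemma (in prob_space) exp_moment_le:
  fixes h f :: "'a \<Rightarrow> real"
  assumes [measurable]: "h \<in> borel_measurable M" "f \<in> borel_measurable M"
    and h: "\<And>a. a \<in> space M \<Longrightarrow> 0 \<le> h a" "\<And>a. a \<in> space M \<Longrightarrow> h a \<le> K"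
    and h1: "(\<integral>a. h a \<partial>M) = 1"
    and f: "\<And>a. a \<in> space M \<Longrightarrow> 0 \<le> f a" "\<And>a. a \<in> space M \<Longrightarrow> f a \<le> 1"
  shows "(\<integral>a. h a * exp (l * (f a - (\<integral>a. h a * f a \<partial>M))) \<partial>M) \<le> exp (l\<^sup>2 / 8)"
proof -
  have aux: "(\<integral>a. h a * exp (l * (g a - (\<integral>a. h a * g a \<partial>M))) \<partial>M) \<le> exp (l\<^sup>2 / 8)"
    if l: "l > 0" and [measurable]: "g \<in> borel_measurable M"
    and g: "\<And>a. a \<in> space M \<Longrightarrow> 0 \<le> g a" "\<And>a. a \<in> space M \<Longrightarrow> g a \<le> 1" for l g
  proof -
    \<comment> \<open>Reweighting by \<open>h\<close> gives a probability measure, to which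
      Hoeffding's lemma applies; \<open>integral_density\<close> translates the result back.\<close>
    let ?D = "density M (\<lambda>a. ennreal (h a))"
    have ih: "integrable M h"
      by (rule integrable_bounded[where C=K]) (use h in auto)
    have nn: "AE a in M. 0 \<le> h a" using h by (auto intro: AE_I2)
    have D: "prob_space ?D"
      using nn ih h1 by (intro prob_spaceI) (simp add: emeasure_density nn_integral_eq_integral cong: nn_integral_cong)
    interpret D: prob_space ?D by fact
    interpret ib: interval_bounded_random_variable ?D g 0 1
      by unfold_locales (use g in \<open>auto intro!: AE_I2\<close>)
    have "ennreal (\<integral>a. exp (l * (g a - D.expectation g)) \<partial>?D)
        = (\<integral>\<^sup>+a. exp (l * (g a - D.expectation g)) \<partial>?D)"
    proof (rule nn_integral_eq_integral[symmetric])
      show "integrable ?D (\<lambda>a. exp (l * (g a - D.expectation g)))"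
      proof (rule D.integrable_bounded)
        fix a assume "a \<in> space ?D"
        then have "l * (g a - D.expectation g) \<le> l * (1 - D.expectation g)" 
          using l g by (intro mult_left_mono) auto
        then show "\<bar>exp (l * (g a - D.expectation g))\<bar> \<le> exp (l * (1 - D.expectation g))"
          by simp
      qed auto
    qed auto
    also have "\<dots> \<le> ennreal (exp (l\<^sup>2 * (1 - 0)\<^sup>2 / 8))"
      using ib.Hoeffdings_lemma_nn_integral[OF l] by simp
    finally have "(\<integral>a. exp (l * (g a - D.expectation g)) \<partial>?D) \<le> exp (l\<^sup>2 / 8)" by simp
    moreover have "D.expectation g = (\<integral>a. h a * g a \<partial>M)"
      using nn by (subst integral_density) auto
    ultimately show ?thesis
      using nn by (subst (asm) integral_density) auto
  qed
  consider "l > 0" | "l = 0" | "l < 0" by linarith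
  then show ?thesis
  proof cases
    case 1 then show ?thesis by (intro aux) (use f in auto)
  next
    case 2 then show ?thesis using h1 by simp
  next
    \<comment> \<open>Replacing \<open>f\<close> by \<open>1 - f\<close> negates the centred
      variable and turns \<open>l\<close> into the positive number \<open>-l\<close>.\<close>
    case 3
    have ih: "integrable M h"
      by (rule integrable_bounded[where C=K]) (use h in auto)
    have ihf: "integrable M (\<lambda>a. h a * f a)"
      by (rule integrable_weighted[where K=K and C=1]) (use h f in auto)
    have "(\<integral>a. h a * (1 - f a) \<partial>M) = 1 - (\<integral>a. h a * f a \<partial>M)"
      using ih ihf h1 by (simp add: right_diff_distrib)
    moreover have "(\<integral>a. h a * exp ((-l) * ((1 - f a) - (\<integral>a. h a * (1 - f a) \<partial>M))) \<partial>M)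
      \<le> exp ((-l)\<^sup>2 / 8)"
      using 3 by (intro aux) (use f in auto)
    moreover have "(-l) * ((1 - f a) - (1 - c)) = l * (f a - c)" for a c
      by (simp add: algebra_simps)
    ultimately show ?thesis by simp
  qed
qed

section \<open>Independent copies of one message\<close>

lemma (in prob_space) product_sigma_finite_const: "product_sigma_finite (\<lambda>_. M)"
  by unfold_locales

lemma (in prob_space) prob_space_PiM_const: "prob_space (PiM I (\<lambda>_. M))"
  by (intro prob_space_PiM) unfold_locales

text \<open>Relative entropy is additive over independent copies. As \<open>h\<close> may vanish,
  the logarithm of the product cannot simply be split; each summand is instead kept as a product
  over the coordinates, whose integral factorises.\<close>

lemma (in prob_space) relative_entropy_iid:
  fixes h :: "'a \<Rightarrow> real" and t :: nat
  assumes [measurable]: "h \<in> borel_measurable M"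
    and h: "\<And>a. a \<in> space M \<Longrightarrow> 0 \<le> h a" "\<And>a. a \<in> space M \<Longrightarrow> h a \<le> K"
    and h1: "(\<integral>a. h a \<partial>M) = 1"
  shows "(\<integral>\<omega>. (\<Prod>i<t. h (\<omega> i)) * ln (\<Prod>i<t. h (\<omega> i)) \<partial>PiM {..<t} (\<lambda>_. M))
    = t * (\<integral>a. h a * ln (h a) \<partial>M)"
proof -
  interpret PS: product_sigma_finite "\<lambda>_. M" by (rule product_sigma_finite_const)
  let ?P = "PiM {..<t} (\<lambda>_. M)"
  have ih: "integrable M h"
    by (rule integrable_bounded[where C=K]) (use h in auto)
  have il: "integrable M (\<lambda>a. h a * ln (h a))" by (rule integrable_times_ln[OF assms(1) h])
  \<comment> \<open>Summand \<open>j\<close> carries \<open>h * ln h\<close> in coordinate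
    \<open>j\<close> and \<open>h\<close> in all others. Every other factor then integrates to
    1.\<close>
  define g where "g = (\<lambda>(j::nat) i a. if i = j then h a * ln (h a) else h a)"
  have ig: "integrable M (g j i)" for j i
    unfolding g_def using ih il by (cases "i = j") auto
  have eq: "(\<Prod>i\<in>{..<t}. h (\<omega> i)) * ln (\<Prod>i\<in>{..<t}. h (\<omega> i))
      = (\<Sum>j\<in>{..<t}. \<Prod>i\<in>{..<t}. g j i (\<omega> i))"
    if "\<omega> \<in> space ?P" for \<omega> :: "nat \<Rightarrow> 'a"
  proof -
    have s: "\<omega> i \<in> space M" if "i < t" for i
      using that \<open>\<omega> \<in> space ?P\<close> by (auto simp: space_PiM PiE_iff)
    have gj: "(\<Prod>i<t. g j i (\<omega> i)) = (\<Prod>i<t. h (\<omega> i)) * ln (h (\<omega> j))" if "j < t" for j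
    proof -
      have "(\<Prod>i<t. g j i (\<omega> i)) = g j j (\<omega> j) * (\<Prod>i\<in>{..<t}-{j}. g j i (\<omega> i))"
        using that by (intro prod.remove) auto
      also have "(\<Prod>i\<in>{..<t}-{j}. g j i (\<omega> i)) = (\<Prod>i\<in>{..<t}-{j}. h (\<omega> i))"
        by (intro prod.cong) (auto simp: g_def)
      also have "g j j (\<omega> j) * (\<Prod>i\<in>{..<t}-{j}. h (\<omega> i))
          = ln (h (\<omega> j)) * (h (\<omega> j) * (\<Prod>i\<in>{..<t}-{j}. h (\<omega> i)))"
        by (simp add: g_def)
      also have "h (\<omega> j) * (\<Prod>i\<in>{..<t}-{j}. h (\<omega> i)) = (\<Prod>i<t. h (\<omega> i))"
        using that by (intro prod.remove[symmetric]) auto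
      finally show ?thesis by simp
    qed
    show ?thesis
    proof (cases "\<exists>i<t. h (\<omega> i) = 0")
      \<comment> \<open>If some factor vanishes, so does the whole product, and with it both sides,
        whatever value \<open>ln 0\<close> has.\<close>
      case True
      then have p0: "(\<Prod>i<t. h (\<omega> i)) = 0" by auto
      have "(\<Sum>j<t. \<Prod>i<t. g j i (\<omega> i)) = (\<Sum>j<t. 0)"
        by (intro sum.cong refl) (simp only: gj lessThan_iff p0 mult_zero_left)
      then show ?thesis by (simp only: p0 mult_zero_left sum.neutral_const)
    next
      case False
      then have "h (\<omega> i) > 0" if "i < t" for i
        using h(1)[OF s[OF that]] that by (metis less_eq_real_def)
      then have "ln (\<Prod>i<t. h (\<omega> i)) = (\<Sum>i<t. ln (h (\<omega> i)))"
        by (intro ln_prod finite_lessThan) (metis lessThan_iff less_irrefl)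
      then show ?thesis using gj by (simp add: sum_distrib_left)
    qed
  qed
  have "(\<integral>\<omega>. (\<Prod>i<t. h (\<omega> i)) * ln (\<Prod>i<t. h (\<omega> i)) \<partial>?P)
    = (\<integral>\<omega>. (\<Sum>j<t. \<Prod>i<t. g j i (\<omega> i)) \<partial>?P)"
    by (intro Bochner_Integration.integral_cong) (auto simp: eq)
  also have "\<dots> = (\<Sum>j<t. \<integral>\<omega>. (\<Prod>i<t. g j i (\<omega> i)) \<partial>?P)"
    by (intro Bochner_Integration.integral_sum PS.product_integrable_prod ig) auto
  also have "\<dots> = (\<Sum>j<t. \<Prod>i<t. \<integral>a. g j i a \<partial>M)"
    by (intro sum.cong refl PS.product_integral_prod ig) auto
  also have "\<dots> = (\<Sum>j<t. (\<integral>a. h a * ln (h a) \<partial>M))"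
  proof (intro sum.cong refl)
    fix j assume "j \<in> {..<t}"
    then have "(\<Prod>i<t. \<integral>a. g j i a \<partial>M)
       = (\<integral>a. g j j a \<partial>M) * (\<Prod>i\<in>{..<t}-{j}. \<integral>a. g j i a \<partial>M)"
      by (intro prod.remove) auto
    also have "(\<Prod>i\<in>{..<t}-{j}. \<integral>a. g j i a \<partial>M) = (\<Prod>i\<in>{..<t}-{j}. 1)"
      using h1 by (intro prod.cong) (auto simp: g_def)
    finally show "(\<Prod>i<t. \<integral>a. g j i a \<partial>M) = (\<integral>a. h a * ln (h a) \<partial>M)"
      by (simp add: g_def)
  qed
  finally show ?thesis by simp
qed

lemma abs_mult_le:
  fixes a b K C :: real
  assumes "0 \<le> a" "a \<le> K" "\<bar>b\<bar> \<le> C"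
  shows "\<bar>a * b\<bar> \<le> K * C"
  unfolding abs_mult using assms by (intro mult_mono) auto

lemma (in prob_space) weighted_mean_bounds:
  fixes h f :: "'a \<Rightarrow> real"
  assumes [measurable]: "h \<in> borel_measurable M" "f \<in> borel_measurable M"
    and h: "\<And>a. a \<in> space M \<Longrightarrow> 0 \<le> h a" "\<And>a. a \<in> space M \<Longrightarrow> h a \<le> K"
    and h1: "(\<integral>a. h a \<partial>M) = 1"
    and f: "\<And>a. a \<in> space M \<Longrightarrow> 0 \<le> f a" "\<And>a. a \<in> space M \<Longrightarrow> f a \<le> 1"
  shows "0 \<le> (\<integral>a. h a * f a \<partial>M)" "(\<integral>a. h a * f a \<partial>M) \<le> 1"
proof -
  show "0 \<le> (\<integral>a. h a * f a \<partial>M)" using h f by (intro integral_nonneg_AE AE_I2) auto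
  have "(\<integral>a. h a * f a \<partial>M) \<le> (\<integral>a. h a \<partial>M)"
  proof (rule integral_mono)
    show "integrable M h" by (rule integrable_bounded[where C=K]) (use h in auto)
    show "integrable M (\<lambda>a. h a * f a)"
      by (rule integrable_weighted[where K=K and C=1]) (use h f in auto)
  qed (use h f in \<open>auto intro: mult_left_le\<close>)
  with h1 show "(\<integral>a. h a * f a \<partial>M) \<le> 1" by simp
qed

text \<open>By independence the moment is a product of \<open>t\<close> single-copy moments, each
  bounded by \<open>exp_moment_le\<close>.\<close>

lemma (in prob_space) iid_exp_moment_le:
  fixes h f :: "'a \<Rightarrow> real" and t :: nat and l :: real
  assumes [measurable]: "h \<in> borel_measurable M" "f \<in> borel_measurable M"
    and h: "\<And>a. a \<in> space M \<Longrightarrow> 0 \<le> h a" "\<And>a. a \<in> space M \<Longrightarrow> h a \<le> K"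
    and h1: "(\<integral>a. h a \<partial>M) = 1"
    and f: "\<And>a. a \<in> space M \<Longrightarrow> 0 \<le> f a" "\<And>a. a \<in> space M \<Longrightarrow> f a \<le> 1"
  shows "(\<integral>\<omega>. (\<Prod>i<t. h (\<omega> i)) * exp (l * (\<Sum>i<t. f (\<omega> i) - (\<integral>a. h a * f a \<partial>M)))
      \<partial>PiM {..<t} (\<lambda>_. M)) \<le> exp (t * l\<^sup>2 / 8)"
proof -
  interpret PS: product_sigma_finite "\<lambda>_. M" by (rule product_sigma_finite_const)
  let ?m = "\<integral>a. h a * f a \<partial>M"
  let ?g = "\<lambda>a. h a * exp (l * (f a - ?m))"
  have "\<bar>?g a\<bar> \<le> K * exp (\<bar>l\<bar> * (1 + \<bar>?m\<bar>))" if a: "a \<in> space M" for a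
  proof (rule abs_mult_le[OF h[OF a]])
    have "l * (f a - ?m) \<le> \<bar>l\<bar> * \<bar>f a - ?m\<bar>" using abs_ge_self[of "l * (f a - ?m)"] by (simp add: abs_mult)
    also have "\<dots> \<le> \<bar>l\<bar> * (1 + \<bar>?m\<bar>)" using f[OF a] by (intro mult_left_mono) auto
    finally show "\<bar>exp (l * (f a - ?m))\<bar> \<le> exp (\<bar>l\<bar> * (1 + \<bar>?m\<bar>))" by simp
  qed
  then have ig: "integrable M ?g" by (intro integrable_bounded) auto
  have "(\<integral>\<omega>. (\<Prod>i<t. h (\<omega> i)) * exp (l * (\<Sum>i<t. f (\<omega> i) - ?m)) \<partial>PiM {..<t} (\<lambda>_. M))
    = (\<integral>\<omega>. (\<Prod>i<t. ?g (\<omega> i)) \<partial>PiM {..<t} (\<lambda>_. M))"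
    by (simp add: sum_distrib_left exp_sum prod.distrib)
  also have "\<dots> = (\<integral>a. ?g a \<partial>M) ^ t"
    by (subst PS.product_integral_prod) (use ig in auto)
  also have "\<dots> \<le> exp (l\<^sup>2 / 8) ^ t"
    using h by (intro power_mono exp_moment_le[where K=K] integral_nonneg_AE AE_I2) (use assms in auto)
  also have "\<dots> = exp (t * l\<^sup>2 / 8)" by (simp add: exp_of_nat_mult[symmetric])
  finally show ?thesis .
qed

lemma measurable_PiM_coordinate_pair:
  assumes W: "case_prod W \<in> borel_measurable (M \<Otimes>\<^sub>M N)" and "i \<in> I"
  shows "(\<lambda>p. W (fst p i) (snd p)) \<in> borel_measurable (PiM I (\<lambda>_. M) \<Otimes>\<^sub>M N)"
proof -
  have "(\<lambda>p. (fst p i, snd p)) \<in> PiM I (\<lambda>_. M) \<Otimes>\<^sub>M N \<rightarrow>\<^sub>M M \<Otimes>\<^sub>M N"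
    using \<open>i \<in> I\<close> by measurable
  from measurable_compose[OF this W] show ?thesis by simp
qed

text \<open>
  A union bound over the reference measure \<open>N\<close> instead of over \<open>y\<close>: changing measure from \<open>N\<close> to
  the density \<open>k y\<close> costs only the relative entropy \<open>D\<close>, for all \<open>y\<close> simultaneously.
\<close>

lemma pac_bayes_deviation:
  fixes M :: "'a measure" and N :: "'b measure" and W :: "'a \<Rightarrow> 'b \<Rightarrow> real"
    and h :: "'a \<Rightarrow> real" and k :: "'y \<Rightarrow> 'b \<Rightarrow> real" and t :: nat and \<gamma> D K :: real
  assumes M: "prob_space M" and N: "prob_space N"
    and W: "case_prod W \<in> borel_measurable (M \<Otimes>\<^sub>M N)"
    and W01: "\<And>a b. 0 \<le> W a b" "\<And>a b. W a b \<le> 1"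
    and hm[measurable]: "h \<in> borel_measurable M"
    and h: "\<And>a. a \<in> space M \<Longrightarrow> 0 \<le> h a" "\<And>a. a \<in> space M \<Longrightarrow> h a \<le> K"
    and h1: "(\<integral>a. h a \<partial>M) = 1"
    and G: "finite G"
    and km: "\<And>y. y \<in> G \<Longrightarrow> k y \<in> borel_measurable N"
    and k: "\<And>y b. y \<in> G \<Longrightarrow> b \<in> space N \<Longrightarrow> 0 \<le> k y b" "\<And>y b. y \<in> G \<Longrightarrow> b \<in> space N \<Longrightarrow> k y b \<le> K"
    and k1: "\<And>y. y \<in> G \<Longrightarrow> (\<integral>b. k y b \<partial>N) = 1"
    and kD: "\<And>y. y \<in> G \<Longrightarrow> (\<integral>b. k y b * ln (k y b) \<partial>N) \<le> D"
    and \<gamma>: "\<gamma> > 0" and t: "D + ln 4 \<le> 2 * \<gamma>\<^sup>2 * t"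
  fixes V :: "'y \<Rightarrow> 'a \<Rightarrow> real" and v :: "'y \<Rightarrow> real"
  defines "V \<equiv> \<lambda>y a. \<integral>b. k y b * W a b \<partial>N"
  defines "v \<equiv> \<lambda>y. \<integral>a. h a * V y a \<partial>M"
  shows "(\<integral>\<omega>. (\<Prod>i<t. h (\<omega> i)) * indicator {\<omega>. \<exists>y\<in>G. \<gamma> * t \<le> \<bar>\<Sum>i<t. V y (\<omega> i) - v y\<bar>} \<omega>
      \<partial>PiM {..<t} (\<lambda>_. M)) \<le> 1 / 2"
proof -
  interpret M: prob_space M by fact
  interpret N: prob_space N by fact
  let ?P = "PiM {..<t} (\<lambda>_. M)"
  interpret P: prob_space ?P by (rule M.prob_space_PiM_const)
  interpret MN: pair_prob_space M N ..
  interpret PN: pair_prob_space ?P N ..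
  note W[measurable]
  have Wa[measurable]: "W a \<in> borel_measurable N" if "a \<in> space M" for a
    using measurable_compose[OF measurable_Pair1'[OF that] W] by simp
  have Wb[measurable]: "(\<lambda>a. W a b) \<in> borel_measurable M" if "b \<in> space N" for b
    using measurable_compose[OF measurable_Pair2'[OF that] W] by simp
  have Wi[measurable]: "(\<lambda>p. W (fst p i) (snd p)) \<in> borel_measurable (?P \<Otimes>\<^sub>M N)" if "i < t" for i
    using that by (intro measurable_PiM_coordinate_pair[OF W]) simp
  \<comment> \<open>\<open>w b\<close> is the mean of \<open>W a b\<close> under Alice's density.
    For fixed \<open>b\<close>, \<open>Z \<omega> b\<close> below is thus a sum of independent
    centred variables, to which Hoeffding's bound applies before any \<open>y\<close> is
    chosen.\<close>
  define w where "w = (\<lambda>b. \<integral>a. h a * W a b \<partial>M)"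
  have wm[measurable]: "w \<in> borel_measurable N"
    unfolding w_def by measurable
  have w01: "0 \<le> w b" "w b \<le> 1" if "b \<in> space N" for b
    unfolding w_def using that h h1 W01 by (auto intro!: M.weighted_mean_bounds[where K=K])
  define Z where "Z = (\<lambda>\<omega> b. \<Sum>i<t. W (\<omega> i) b - w b)"
  have Zm[measurable]: "(\<lambda>p. Z (fst p) (snd p)) \<in> borel_measurable (?P \<Otimes>\<^sub>M N)"
    unfolding Z_def by (intro borel_measurable_sum borel_measurable_diff) auto
  have Zb: "\<bar>Z \<omega> b\<bar> \<le> t" if b: "b \<in> space N" for \<omega> b
  proof -
    have "\<bar>Z \<omega> b\<bar> \<le> (\<Sum>i<t. \<bar>W (\<omega> i) b - w b\<bar>)" unfolding Z_def by (rule sum_abs)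
    also have "\<dots> \<le> (\<Sum>i<t. 1)"
    proof (rule sum_mono)
      fix i show "\<bar>W (\<omega> i) b - w b\<bar> \<le> 1"
        using W01[of "\<omega> i" b] w01[OF b] by (simp add: abs_le_iff)
    qed
    finally show ?thesis by simp
  qed
  have Z\<omega>[measurable]: "Z \<omega> \<in> borel_measurable N" if "\<omega> \<in> space ?P" for \<omega>
    using measurable_compose[OF measurable_Pair1'[OF that] Zm] by simp
  \<comment> \<open>the minimiser of \<open>t * l\<^sup>2 / 8 - l * \<gamma> * t\<close>\<close>
  define l where "l = 4 * \<gamma>"
  \<comment> \<open>The shift is chosen so that a deviation of \<open>\<gamma> * t\<close> gives
    \<open>l * \<bar>S\<bar> - c \<ge> D\<close>. This cancels the relative entropy in the
    Donsker-Varadhan inequality and leaves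
    \<open>1 \<le> exp (-c) * \<Phi> \<omega>\<close>.\<close>
  define c where "c = l * \<gamma> * t - D"
  define H where "H = (\<lambda>\<omega>. \<Prod>i<t. h (\<omega> i))"
  have Hm[measurable]: "H \<in> borel_measurable ?P"
    unfolding H_def by (intro borel_measurable_prod) auto
  have K: "0 \<le> K" using h M.not_empty by (meson all_not_in_conv order_trans)
  have H: "0 \<le> H \<omega>" "H \<omega> \<le> K ^ t" if "\<omega> \<in> space ?P" for \<omega>
  proof -
    have s: "\<omega> i \<in> space M" if "i < t" for i
      using \<open>\<omega> \<in> space ?P\<close> that by (auto simp: space_PiM PiE_iff)
    show "0 \<le> H \<omega>" unfolding H_def using s h by (auto intro!: prod_nonneg)
    have "H \<omega> \<le> (\<Prod>i<t. K)" unfolding H_def using s h by (intro prod_mono) auto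
    then show "H \<omega> \<le> K ^ t" by simp
  qed
  \<comment> \<open>The sum of the two exponentials treats both signs of the deviation at once.
    Since \<open>\<Phi>\<close> does not depend on \<open>y\<close>, bounding its mean controls all
    \<open>y \<in> G\<close> simultaneously.\<close>
  define \<Phi> where "\<Phi> = (\<lambda>\<omega>. \<integral>b. exp (l * Z \<omega> b) + exp (- l * Z \<omega> b) \<partial>N)"
  have eb: "\<bar>exp (s * Z \<omega> b)\<bar> \<le> exp (\<bar>s\<bar> * t)" if "b \<in> space N" for s \<omega> b
  proof -
    have "s * Z \<omega> b \<le> \<bar>s\<bar> * \<bar>Z \<omega> b\<bar>" using abs_ge_self[of "s * Z \<omega> b"] by (simp add: abs_mult)
    also have "\<dots> \<le> \<bar>s\<bar> * t" using Zb[OF that] by (intro mult_left_mono) auto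
    finally show ?thesis by simp
  qed
  have ie: "integrable N (\<lambda>b. exp (s * Z \<omega> b))" if "\<omega> \<in> space ?P" for s \<omega>
    using that eb[of _ s \<omega>] by (intro N.integrable_bounded[where C="exp (\<bar>s\<bar> * t)"]) auto
  have \<Phi>m[measurable]: "\<Phi> \<in> borel_measurable ?P"
    unfolding \<Phi>_def using Zm by (intro N.borel_measurable_lebesgue_integral) (simp add: split_beta')
  \<comment> \<open>By Fubini, averaging the centred sum \<open>Z\<close> with weight
    \<open>k y\<close> gives the centred sum belonging to \<open>y\<close>. This is the linear
    functional that the change of measure estimates.\<close>
  have mean: "(\<integral>b. k y b * Z \<omega> b \<partial>N) = (\<Sum>i<t. V y (\<omega> i) - v y)"
    if y: "y \<in> G" and \<omega>: "\<omega> \<in> space ?P" for y \<omega>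
  proof -
    note km[OF y, measurable]
    have s: "\<omega> i \<in> space M" if "i < t" for i
      using \<omega> that by (auto simp: space_PiM PiE_iff)
    have i1: "integrable N (\<lambda>b. k y b * W a b)" if "a \<in> space M" for a
      using that W01 k[OF y] by (intro N.integrable_weighted[where K=K and C=1]) auto
    have i2: "integrable N (\<lambda>b. k y b * w b)"
      using w01 k[OF y] by (intro N.integrable_weighted[where K=K and C=1]) auto
    have "(\<integral>b. k y b * w b \<partial>N) = (\<integral>b. (\<integral>a. k y b * h a * W a b \<partial>M) \<partial>N)"
      unfolding w_def by (simp add: mult.assoc)
    also have "\<dots> = (\<integral>a. (\<integral>b. k y b * h a * W a b \<partial>N) \<partial>M)"
    proof (rule MN.Fubini_integral)
      have "integrable (M \<Otimes>\<^sub>M N) (\<lambda>p. k y (snd p) * (h (fst p) * W (fst p) (snd p)))"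
        using h k[OF y] W01 W
        by (intro MN.integrable_bounded[where C="K * (K * 1)"] abs_mult_le)
          (auto simp: space_pair_measure split_beta')
      then show "integrable (M \<Otimes>\<^sub>M N) (\<lambda>(a, b). k y b * h a * W a b)"
        by (simp add: split_beta' mult.assoc)
    qed
    also have "\<dots> = v y"
      unfolding v_def V_def by (simp add: mult.assoc mult.left_commute[of "k y _"])
    finally have "(\<integral>b. k y b * w b \<partial>N) = v y" .
    moreover have "(\<integral>b. k y b * Z \<omega> b \<partial>N) = (\<integral>b. (\<Sum>i<t. k y b * W (\<omega> i) b - k y b * w b) \<partial>N)"
      by (simp add: Z_def sum_distrib_left right_diff_distrib)
    moreover have "\<dots> = (\<Sum>i<t. V y (\<omega> i) - (\<integral>b. k y b * w b \<partial>N))"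
      unfolding V_def using i1 i2 s by simp
    ultimately show ?thesis by simp
  qed
  have dev: "1 \<le> exp (-c) * \<Phi> \<omega>"
    if y: "y \<in> G" and \<omega>: "\<omega> \<in> space ?P" and S: "\<gamma> * t \<le> \<bar>\<Sum>i<t. V y (\<omega> i) - v y\<bar>" for y \<omega>
  proof -
    note km[OF y, measurable]
    let ?S = "\<Sum>i<t. V y (\<omega> i) - v y"
    obtain \<sigma> :: real where \<sigma>: "\<sigma> = 1 \<or> \<sigma> = -1" "\<sigma> * ?S = \<bar>?S\<bar>"
      by (cases "?S \<ge> 0") force+
    have "(\<integral>b. k y b * (\<sigma> * l * Z \<omega> b - c) \<partial>N) \<le> (\<integral>b. k y b * ln (k y b) \<partial>N)
        + (\<integral>b. exp (\<sigma> * l * Z \<omega> b - c) \<partial>N) - 1"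
    proof (rule N.donsker_varadhan_le)
      fix b assume b: "b \<in> space N"
      have "\<bar>\<sigma> * l * Z \<omega> b - c\<bar> \<le> \<bar>\<sigma> * l * Z \<omega> b\<bar> + \<bar>c\<bar>" by simp
      also have "\<bar>\<sigma> * l * Z \<omega> b\<bar> = \<bar>l\<bar> * \<bar>Z \<omega> b\<bar>" using \<sigma> by (auto simp: abs_mult)
      also have "\<dots> \<le> \<bar>l\<bar> * t" using Zb[OF b] by (intro mult_left_mono) auto
      finally show "\<bar>\<sigma> * l * Z \<omega> b - c\<bar> \<le> \<bar>l\<bar> * t + \<bar>c\<bar>" by simp
    qed (use \<omega> k[OF y] k1[OF y] in auto)
    moreover have "(\<integral>b. k y b * (\<sigma> * l * Z \<omega> b - c) \<partial>N) = l * \<bar>?S\<bar> - c"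
    proof -
      have "integrable N (\<lambda>b. k y b * Z \<omega> b)"
        using \<omega> Zb k[OF y] by (intro N.integrable_weighted[where K=K and C=t]) auto
      moreover have "integrable N (k y)"
        using k[OF y] by (intro N.integrable_bounded[where C=K]) auto
      ultimately have "(\<integral>b. \<sigma> * l * (k y b * Z \<omega> b) - c * k y b \<partial>N) = \<sigma> * l * ?S - c"
        using k1[OF y] mean[OF y \<omega>] by simp
      then show ?thesis using \<sigma>(2) by (simp add: algebra_simps)
    qed
    moreover have "(\<integral>b. exp (\<sigma> * l * Z \<omega> b - c) \<partial>N) \<le> exp (-c) * \<Phi> \<omega>"
    proof -
      have "(\<integral>b. exp (\<sigma> * l * Z \<omega> b - c) \<partial>N) = exp (-c) * (\<integral>b. exp (\<sigma> * l * Z \<omega> b) \<partial>N)"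
        by (simp add: exp_diff exp_minus field_simps)
      also have "(\<integral>b. exp (\<sigma> * l * Z \<omega> b) \<partial>N) \<le> \<Phi> \<omega>"
        unfolding \<Phi>_def using \<sigma>(1) ie[OF \<omega>, of l] ie[OF \<omega>, of "-l"]
        by (intro integral_mono Bochner_Integration.integrable_add) auto
      finally show ?thesis by simp
    qed
    moreover have "l * (\<gamma> * t) \<le> l * \<bar>?S\<bar>" using S \<gamma> by (intro mult_left_mono) (auto simp: l_def)
    ultimately show ?thesis using kD[OF y] by (simp add: c_def mult.assoc)
  qed
  have moment: "(\<integral>\<omega>. H \<omega> * exp (s * l * Z \<omega> b) \<partial>?P) \<le> exp (t * l\<^sup>2 / 8)"
    if b: "b \<in> space N" and s: "s = 1 \<or> s = -1" for b and s :: real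
  proof -
    have "(\<integral>\<omega>. H \<omega> * exp ((s * l) * Z \<omega> b) \<partial>?P) \<le> exp (t * (s * l)\<^sup>2 / 8)"
      unfolding H_def Z_def w_def using b h h1 W01
      by (intro M.iid_exp_moment_le[where K=K]) auto
    with s show ?thesis by auto
  qed
  have iH: "integrable (?P \<Otimes>\<^sub>M N) (\<lambda>p. H (fst p) * exp (s * Z (fst p) (snd p)))" for s
  proof (rule PN.integrable_bounded)
    fix p assume "p \<in> space (?P \<Otimes>\<^sub>M N)"
    then show "\<bar>H (fst p) * exp (s * Z (fst p) (snd p))\<bar> \<le> K ^ t * exp (\<bar>s\<bar> * t)"
      using H eb by (intro abs_mult_le) (auto simp: space_pair_measure)
  qed measurable
  have Zb'[measurable]: "(\<lambda>\<omega>. Z \<omega> b) \<in> borel_measurable ?P" if "b \<in> space N" for b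
    using measurable_compose[OF measurable_Pair2'[OF that] Zm] by simp
  have iHP: "integrable ?P (\<lambda>\<omega>. H \<omega> * exp (s * Z \<omega> b))" if "b \<in> space N" for s b
    using H eb that
    by (intro P.integrable_weighted[where K="K ^ t" and C="exp (\<bar>s\<bar> * t)"]) auto
  \<comment> \<open>Exchanging the integrals puts the one over the samples inside, where
    \<open>b\<close> is fixed and \<open>moment\<close> applies.\<close>
  have "(\<integral>\<omega>. H \<omega> * \<Phi> \<omega> \<partial>?P)
      = (\<integral>\<omega>. (\<integral>b. H \<omega> * exp (l * Z \<omega> b) + H \<omega> * exp (- l * Z \<omega> b) \<partial>N) \<partial>?P)"
    unfolding \<Phi>_def by (simp add: distrib_left flip: integral_mult_right_zero)
  also have "\<dots> = (\<integral>b. (\<integral>\<omega>. H \<omega> * exp (l * Z \<omega> b) + H \<omega> * exp (- l * Z \<omega> b) \<partial>?P) \<partial>N)"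
    using iH[of l] iH[of "-l"] by (intro PN.Fubini_integral[symmetric]) (simp add: split_beta')
  also have "\<dots> \<le> (\<integral>b. 2 * exp (t * l\<^sup>2 / 8) \<partial>N)"
  proof (rule integral_mono)
    show "integrable N (\<lambda>b. \<integral>\<omega>. H \<omega> * exp (l * Z \<omega> b) + H \<omega> * exp (- l * Z \<omega> b) \<partial>?P)"
      using iH[of l] iH[of "-l"] by (intro PN.integrable_snd) (simp add: split_beta')
    fix b assume b: "b \<in> space N"
    show "(\<integral>\<omega>. H \<omega> * exp (l * Z \<omega> b) + H \<omega> * exp (- l * Z \<omega> b) \<partial>?P) \<le> 2 * exp (t * l\<^sup>2 / 8)"
      using moment[OF b, of 1] moment[OF b, of "-1"] iHP[OF b, of l] iHP[OF b, of "-l"] by simp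
  qed auto
  finally have H\<Phi>: "(\<integral>\<omega>. H \<omega> * \<Phi> \<omega> \<partial>?P) \<le> 2 * exp (t * l\<^sup>2 / 8)"
    by (simp add: N.prob_space)
  have \<Phi>b: "\<bar>\<Phi> \<omega>\<bar> \<le> 2 * exp (\<bar>l\<bar> * t)" "0 \<le> \<Phi> \<omega>" if "\<omega> \<in> space ?P" for \<omega>
  proof -
    show 0: "0 \<le> \<Phi> \<omega>" unfolding \<Phi>_def by (intro integral_nonneg_AE AE_I2) (simp add: add_nonneg_nonneg)
    have "\<Phi> \<omega> \<le> (\<integral>b. exp (\<bar>l\<bar> * t) + exp (\<bar>l\<bar> * t) \<partial>N)"
      unfolding \<Phi>_def using ie[OF that, of l] ie[OF that, of "-l"] eb[of _ l \<omega>] eb[of _ "-l" \<omega>]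
      by (intro integral_mono Bochner_Integration.integrable_add add_mono) auto
    then show "\<bar>\<Phi> \<omega>\<bar> \<le> 2 * exp (\<bar>l\<bar> * t)" using 0 by (simp add: N.prob_space)
  qed
  let ?bad = "{\<omega>. \<exists>y\<in>G. \<gamma> * t \<le> \<bar>\<Sum>i<t. V y (\<omega> i) - v y\<bar>}"
  have iH\<Phi>: "integrable ?P (\<lambda>\<omega>. H \<omega> * (exp (-c) * \<Phi> \<omega>))"
  proof (rule P.integrable_bounded)
    fix \<omega> assume "\<omega> \<in> space ?P"
    then show "\<bar>H \<omega> * (exp (-c) * \<Phi> \<omega>)\<bar> \<le> K ^ t * (exp (-c) * (2 * exp (\<bar>l\<bar> * t)))"
      using H \<Phi>b by (intro abs_mult_le) auto
  qed measurable
  have "(\<integral>\<omega>. H \<omega> * indicator ?bad \<omega> \<partial>?P) \<le> (\<integral>\<omega>. H \<omega> * (exp (-c) * \<Phi> \<omega>) \<partial>?P)"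
  proof (rule integral_mono_AE'[OF iH\<Phi>])
    show "AE \<omega> in ?P. H \<omega> * indicator ?bad \<omega> \<le> H \<omega> * (exp (-c) * \<Phi> \<omega>)"
    proof (rule AE_I2)
      fix \<omega> assume \<omega>: "\<omega> \<in> space ?P"
      have "indicator ?bad \<omega> \<le> exp (-c) * \<Phi> \<omega>"
        using dev[OF _ \<omega>] \<Phi>b[OF \<omega>] by (auto simp: indicator_def)
      then show "H \<omega> * indicator ?bad \<omega> \<le> H \<omega> * (exp (-c) * \<Phi> \<omega>)"
        using H[OF \<omega>] by (intro mult_left_mono) auto
    qed
    show "AE \<omega> in ?P. 0 \<le> H \<omega> * (exp (-c) * \<Phi> \<omega>)" using H \<Phi>b by (intro AE_I2) auto
  qed
  also have "\<dots> = exp (-c) * (\<integral>\<omega>. H \<omega> * \<Phi> \<omega> \<partial>?P)"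
    by (subst integral_mult_right_zero[symmetric]) (simp only: mult.left_commute)
  also have "\<dots> \<le> exp (-c) * (2 * exp (t * l\<^sup>2 / 8))" using H\<Phi> by (intro mult_left_mono) auto
  \<comment> \<open>With \<open>l = 4 * \<gamma>\<close> the terms of the exponent that contain
    \<open>t\<close> are \<open>2 * \<gamma>\<^sup>2 * t - 4 * \<gamma>\<^sup>2 * t\<close>. The
    \<open>ln 4\<close> in the hypothesis on \<open>t\<close> turns the remaining factor 2 into
    \<open>1/2\<close>.\<close>
  also have "\<dots> = 2 * exp (D - 2 * \<gamma>\<^sup>2 * t)"
    by (simp add: exp_add[symmetric] c_def l_def power2_eq_square field_simps)
  also have "\<dots> \<le> 2 * exp (- ln 4)" using t by simp
  also have "\<dots> = 1 / 2" by (simp add: exp_minus)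
  finally show ?thesis unfolding H_def .
qed

section \<open>Decoding from independent copies\<close>

text \<open>A Fano-type count. The decoding events are disjoint and each has probability at least
  \<open>1/2\<close> under its own input, while under the common reference law their probabilities
  sum to at most 1. Separating the inputs this way requires relative entropy of order
  \<open>ln (card G)\<close>, and \<open>t\<close> copies supply at most
  \<open>t * D\<close>.\<close>

lemma decoding_bound:
  fixes M :: "'a measure" and N :: "'b measure" and W :: "'a \<Rightarrow> 'b \<Rightarrow> real"
    and h :: "'x \<Rightarrow> 'a \<Rightarrow> real" and k :: "'x \<Rightarrow> 'b \<Rightarrow> real" and t :: nat and \<epsilon> D K :: real
  assumes M: "prob_space M" and N: "prob_space N"
    and W: "case_prod W \<in> borel_measurable (M \<Otimes>\<^sub>M N)"
    and W01: "\<And>a b. 0 \<le> W a b" "\<And>a b. W a b \<le> 1"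
    and G: "finite G" "G \<noteq> {}"
    and hm: "\<And>x. x \<in> G \<Longrightarrow> h x \<in> borel_measurable M"
    and h: "\<And>x a. x \<in> G \<Longrightarrow> a \<in> space M \<Longrightarrow> 0 \<le> h x a" "\<And>x a. x \<in> G \<Longrightarrow> a \<in> space M \<Longrightarrow> h x a \<le> K"
    and h1: "\<And>x. x \<in> G \<Longrightarrow> (\<integral>a. h x a \<partial>M) = 1"
    and hD: "\<And>x. x \<in> G \<Longrightarrow> (\<integral>a. h x a * ln (h x a) \<partial>M) \<le> D"
    and km: "\<And>x. x \<in> G \<Longrightarrow> k x \<in> borel_measurable N"
    and k: "\<And>x b. x \<in> G \<Longrightarrow> b \<in> space N \<Longrightarrow> 0 \<le> k x b" "\<And>x b. x \<in> G \<Longrightarrow> b \<in> space N \<Longrightarrow> k x b \<le> K"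
    and k1: "\<And>x. x \<in> G \<Longrightarrow> (\<integral>b. k x b \<partial>N) = 1"
    and kD: "\<And>x. x \<in> G \<Longrightarrow> (\<integral>b. k x b * ln (k x b) \<partial>N) \<le> D"
    and acc: "\<And>x. x \<in> G \<Longrightarrow> 1 - \<epsilon> \<le> (\<integral>a. h x a * (\<integral>b. k x b * W a b \<partial>N) \<partial>M)"
    and rej: "\<And>x y. x \<in> G \<Longrightarrow> y \<in> G \<Longrightarrow> x \<noteq> y \<Longrightarrow>
      (\<integral>a. h x a * (\<integral>b. k y b * W a b \<partial>N) \<partial>M) \<le> \<epsilon>"
    and \<epsilon>: "\<epsilon> < 1 / 2" and t: "D + ln 4 \<le> 2 * (1 / 2 - \<epsilon>)\<^sup>2 * t"
  shows "ln (card G) \<le> 2 * (t * D + 1)"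
proof -
  interpret M: prob_space M by fact
  interpret N: prob_space N by fact
  interpret PS: product_sigma_finite "\<lambda>_. M" by (rule M.product_sigma_finite_const)
  let ?P = "PiM {..<t} (\<lambda>_. M)"
  interpret P: prob_space ?P by (rule M.prob_space_PiM_const)
  note W[measurable] hm[measurable] km[measurable]
  define V where "V = (\<lambda>y a. \<integral>b. k y b * W a b \<partial>N)"
  have Vm[measurable]: "V y \<in> borel_measurable M" if [measurable]: "y \<in> G" for y
    unfolding V_def by measurable
  define H where "H = (\<lambda>x \<omega>. \<Prod>i<t. h x (\<omega> i))"
  \<comment> \<open>Strict inequality for \<open>x\<close> against weak inequality for the others
    makes the events disjoint. Membership in \<open>E x\<close> says that \<open>x\<close> is the
    only candidate in \<open>G\<close> with average above \<open>1/2\<close>.\<close>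
  define E where "E = (\<lambda>x. {\<omega>\<in>space ?P. t / 2 < (\<Sum>i<t. V x (\<omega> i)) \<and>
    (\<forall>y\<in>G. y \<noteq> x \<longrightarrow> (\<Sum>i<t. V y (\<omega> i)) \<le> t / 2)})"
  have Sm[measurable]: "(\<lambda>\<omega>. \<Sum>i<t. V y (\<omega> i)) \<in> borel_measurable ?P" if [measurable]: "y \<in> G" for y
    by measurable
  have Em: "E x \<in> sets ?P" if [measurable]: "x \<in> G" for x
    unfolding E_def using G(1) by measurable
  have Hm[measurable]: "H x \<in> borel_measurable ?P" if [measurable]: "x \<in> G" for x
    unfolding H_def by measurable
  have H: "0 \<le> H x \<omega>" "H x \<omega> \<le> K ^ t" if "\<omega> \<in> space ?P" "x \<in> G" for x \<omega>
  proof -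
    have s: "\<omega> i \<in> space M" if "i < t" for i
      using \<open>\<omega> \<in> space ?P\<close> that by (auto simp: space_PiM PiE_iff)
    show "0 \<le> H x \<omega>" unfolding H_def using s h \<open>x \<in> G\<close> by (auto intro!: prod_nonneg)
    have "H x \<omega> \<le> (\<Prod>i<t. K)" unfolding H_def using s h \<open>x \<in> G\<close> by (intro prod_mono) auto
    then show "H x \<omega> \<le> K ^ t" by simp
  qed
  have H1: "(\<integral>\<omega>. H x \<omega> \<partial>?P) = 1" if "x \<in> G" for x
  proof -
    have "integrable M (h x)"
      using h that by (intro M.integrable_bounded[where C=K]) auto
    then show ?thesis unfolding H_def using h1[OF that] by (subst PS.product_integral_prod) auto
  qed
  have half: "1 / 2 \<le> (\<integral>\<omega>. H x \<omega> * indicator (E x) \<omega> \<partial>?P)" if x: "x \<in> G" for x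
  proof -
    define v where "v = (\<lambda>y. \<integral>a. h x a * V y a \<partial>M)"
    let ?bad = "{\<omega>. \<exists>y\<in>G. (1 / 2 - \<epsilon>) * t \<le> \<bar>\<Sum>i<t. V y (\<omega> i) - v y\<bar>}"
    have bad: "(\<integral>\<omega>. H x \<omega> * indicator ?bad \<omega> \<partial>?P) \<le> 1 / 2"
      unfolding H_def v_def V_def
      by (rule pac_bayes_deviation[where K=K and D=D]) (use assms x in auto)
    \<comment> \<open>Outside the bad event every average is off by strictly less than
      \<open>1/2 - \<epsilon>\<close>. Starting from at least \<open>1 - \<epsilon>\<close> or at
      most \<open>\<epsilon>\<close>, it stays on its own side of \<open>1/2\<close>.\<close>
    have good: "1 - indicator ?bad \<omega> \<le> (indicator (E x) \<omega> :: real)" if \<omega>: "\<omega> \<in> space ?P" for \<omega>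
    proof (cases "\<omega> \<in> ?bad")
      case False
      then have d: "\<bar>(\<Sum>i<t. V y (\<omega> i)) - t * v y\<bar> < (1 / 2 - \<epsilon>) * t" if "y \<in> G" for y
        using that by (auto simp: sum_subtractf not_le)
      have "(\<Sum>i<t. V y (\<omega> i)) \<le> t / 2" if "y \<in> G" "y \<noteq> x" for y
      proof -
        have "v y \<le> \<epsilon>" using rej[of x y] that x by (auto simp: v_def V_def)
        then have "t * v y \<le> t * \<epsilon>" by (intro mult_left_mono) auto
        then show ?thesis using abs_less_iff[THEN iffD1, OF d[OF that(1)]]
          by (simp add: algebra_simps)
      qed
      moreover have "t / 2 < (\<Sum>i<t. V x (\<omega> i))"
      proof -
        have "1 - \<epsilon> \<le> v x" using acc[OF x] by (auto simp: v_def V_def)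
        then have "t * (1 - \<epsilon>) \<le> t * v x" by (intro mult_left_mono) auto
        then show ?thesis using abs_less_iff[THEN iffD1, OF d[OF x]]
          by (simp add: algebra_simps)
      qed
      ultimately have "\<omega> \<in> E x" using \<omega> by (auto simp: E_def)
      then show ?thesis by simp
    qed simp
    have badm[measurable]: "(indicator ?bad :: _ \<Rightarrow> real) \<in> borel_measurable ?P"
    proof -
      have "{\<omega>\<in>space ?P. \<exists>y\<in>G. (1 / 2 - \<epsilon>) * t \<le> \<bar>(\<Sum>i<t. V y (\<omega> i)) - t * v y\<bar>} \<in> sets ?P"
        using G(1) by measurable
      also have "{\<omega>\<in>space ?P. \<exists>y\<in>G. (1 / 2 - \<epsilon>) * t \<le> \<bar>(\<Sum>i<t. V y (\<omega> i)) - t * v y\<bar>} = ?bad \<inter> space ?P"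
        by (auto simp: sum_subtractf)
      finally show ?thesis by (simp add: borel_measurable_indicator_iff)
    qed
    have iH: "integrable ?P (H x)"
      using H x by (intro P.integrable_bounded[where C="K ^ t"]) auto
    have ib: "integrable ?P (\<lambda>\<omega>. H x \<omega> * indicator ?bad \<omega>)"
      using H x by (intro P.integrable_weighted[where K="K ^ t" and C=1]) auto
    have "1 / 2 \<le> (\<integral>\<omega>. H x \<omega> - H x \<omega> * indicator ?bad \<omega> \<partial>?P)"
      using bad iH ib H1[OF x] by simp
    also have "\<dots> \<le> (\<integral>\<omega>. H x \<omega> * indicator (E x) \<omega> \<partial>?P)"
    proof (rule integral_mono)
      show "integrable ?P (\<lambda>\<omega>. H x \<omega> * indicator (E x) \<omega>)"
        using H x Em by (intro P.integrable_weighted[where K="K ^ t" and C=1]) auto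
      fix \<omega> assume \<omega>: "\<omega> \<in> space ?P"
      have "H x \<omega> * (1 - indicator ?bad \<omega>) \<le> H x \<omega> * indicator (E x) \<omega>"
        using good[OF \<omega>] H[OF \<omega> x] by (intro mult_left_mono) auto
      then show "H x \<omega> - H x \<omega> * indicator ?bad \<omega> \<le> H x \<omega> * indicator (E x) \<omega>"
        by (simp add: right_diff_distrib)
    qed (use iH ib in auto)
    finally show ?thesis .
  qed
  have cG: "1 \<le> real (card G)" using G by (simp add: Suc_le_eq card_gt_0_iff)
  \<comment> \<open>The test function is \<open>?s\<close> times the indicator of
    \<open>E x\<close>. This height makes its exponential jump from 1 to \<open>card G\<close> on
    \<open>E x\<close>, an event whose reference probability is at most \<open>1 / card G\<close> on
    average over \<open>x\<close>.\<close>
  let ?s = "ln (card G)"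
  have s0: "0 \<le> ?s" using cG by simp
  have step: "?s / 2 \<le> t * D + (real (card G) - 1) * P.prob (E x)" if x: "x \<in> G" for x
  proof -
    note Em[OF x, measurable]
    have "?s * (1 / 2) \<le> ?s * (\<integral>\<omega>. H x \<omega> * indicator (E x) \<omega> \<partial>?P)"
      using half[OF x] s0 by (intro mult_left_mono)
    also have "\<dots> = (\<integral>\<omega>. H x \<omega> * (?s * indicator (E x) \<omega>) \<partial>?P)"
      by (subst integral_mult_right_zero[symmetric]) (simp only: mult.left_commute)
    also have "\<dots> \<le> (\<integral>\<omega>. H x \<omega> * ln (H x \<omega>) \<partial>?P) + (\<integral>\<omega>. exp (?s * indicator (E x) \<omega>) \<partial>?P) - 1"
      using x H H1 s0 by (intro P.donsker_varadhan_le[where K="K ^ t" and C="?s"]) (auto simp: indicator_def)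
    also have "(\<integral>\<omega>. H x \<omega> * ln (H x \<omega>) \<partial>?P) = t * (\<integral>a. h x a * ln (h x a) \<partial>M)"
      unfolding H_def using x h h1 by (intro M.relative_entropy_iid[where K=K]) auto
    also have "\<dots> \<le> t * D" using hD[OF x] by (intro mult_left_mono) auto
    also have "(\<integral>\<omega>. exp (?s * indicator (E x) \<omega>) \<partial>?P) = (\<integral>\<omega>. 1 + (real (card G) - 1) * indicator (E x) \<omega> \<partial>?P)"
      using cG by (intro Bochner_Integration.integral_cong) (auto simp: indicator_def)
    also have "\<dots> = 1 + (real (card G) - 1) * P.prob (E x)"
      using P.emeasure_finite[of "E x"] Em[OF x] by (simp add: P.prob_space less_top[symmetric])
    finally show ?thesis by simp
  qed
  have disj: "disjoint_family_on E G"
    unfolding disjoint_family_on_def E_def by fastforce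
  have "(\<Sum>x\<in>G. P.prob (E x)) = P.prob (\<Union>x\<in>G. E x)"
    using Em G(1) disj by (intro P.finite_measure_finite_Union[symmetric]) auto
  then have le1: "(\<Sum>x\<in>G. P.prob (E x)) \<le> 1" by simp
  \<comment> \<open>Summing over \<open>x \<in> G\<close> is where disjointness enters: the
    exponential terms add up to at most \<open>card G - 1\<close>, that is, to less than 1 per
    input.\<close>
  have "card G * (?s / 2) = (\<Sum>x\<in>G. ?s / 2)" by simp
  also have "\<dots> \<le> (\<Sum>x\<in>G. t * D + (real (card G) - 1) * P.prob (E x))"
    by (intro sum_mono step)
  also have "\<dots> = card G * (t * D) + (real (card G) - 1) * (\<Sum>x\<in>G. P.prob (E x))"
    by (simp add: sum.distrib sum_distrib_left)
  also have "\<dots> \<le> card G * (t * D) + (real (card G) - 1) * 1"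
    using cG le1 by (intro add_left_mono mult_left_mono) auto
  also have "\<dots> \<le> card G * (t * D + 1)" by (simp add: algebra_simps)
  finally have "?s / 2 \<le> t * D + 1" using cG by simp
  then show ?thesis by simp
qed

text \<open>Eliminates \<open>t\<close> by taking the least admissible number of copies, roughly
  \<open>D\<close> over twice the squared margin. Then \<open>t * D\<close> is quadratic in
  \<open>D\<close>.\<close>

lemma decoding_bound_quadratic:
  fixes M :: "'a measure" and N :: "'b measure" and W :: "'a \<Rightarrow> 'b \<Rightarrow> real"
    and h :: "'x \<Rightarrow> 'a \<Rightarrow> real" and k :: "'x \<Rightarrow> 'b \<Rightarrow> real" and \<epsilon> D K :: real
  assumes M: "prob_space M" and N: "prob_space N"
    and W: "case_prod W \<in> borel_measurable (M \<Otimes>\<^sub>M N)"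
    and W01: "\<And>a b. 0 \<le> W a b" "\<And>a b. W a b \<le> 1"
    and G: "finite G" "G \<noteq> {}"
    and hm: "\<And>x. x \<in> G \<Longrightarrow> h x \<in> borel_measurable M"
    and h: "\<And>x a. x \<in> G \<Longrightarrow> a \<in> space M \<Longrightarrow> 0 \<le> h x a" "\<And>x a. x \<in> G \<Longrightarrow> a \<in> space M \<Longrightarrow> h x a \<le> K"
    and h1: "\<And>x. x \<in> G \<Longrightarrow> (\<integral>a. h x a \<partial>M) = 1"
    and hD: "\<And>x. x \<in> G \<Longrightarrow> (\<integral>a. h x a * ln (h x a) \<partial>M) \<le> D"
    and km: "\<And>x. x \<in> G \<Longrightarrow> k x \<in> borel_measurable N"
    and k: "\<And>x b. x \<in> G \<Longrightarrow> b \<in> space N \<Longrightarrow> 0 \<le> k x b" "\<And>x b. x \<in> G \<Longrightarrow> b \<in> space N \<Longrightarrow> k x b \<le> K"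
    and k1: "\<And>x. x \<in> G \<Longrightarrow> (\<integral>b. k x b \<partial>N) = 1"
    and kD: "\<And>x. x \<in> G \<Longrightarrow> (\<integral>b. k x b * ln (k x b) \<partial>N) \<le> D"
    and acc: "\<And>x. x \<in> G \<Longrightarrow> 1 - \<epsilon> \<le> (\<integral>a. h x a * (\<integral>b. k x b * W a b \<partial>N) \<partial>M)"
    and rej: "\<And>x y. x \<in> G \<Longrightarrow> y \<in> G \<Longrightarrow> x \<noteq> y \<Longrightarrow>
      (\<integral>a. h x a * (\<integral>b. k y b * W a b \<partial>N) \<partial>M) \<le> \<epsilon>"
    and \<epsilon>: "0 \<le> \<epsilon>" "\<epsilon> < 1 / 2"
  shows "(1 / 2 - \<epsilon>)\<^sup>2 * (ln (card G) - 2) \<le> (D + 1)\<^sup>2"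
proof -
  define g where "g = (1 / 2 - \<epsilon>)\<^sup>2"
  have g0: "0 < g" unfolding g_def using \<epsilon> by simp
  have "g \<le> (1 / 2)\<^sup>2" unfolding g_def using \<epsilon> by (intro power_mono) auto
  then have g1: "g \<le> 1 / 4" by (simp add: power2_eq_square)
  obtain x where x: "x \<in> G" using G by auto
  have D0: "0 \<le> D"
    using prob_space.relative_entropy_nonneg[OF M hm[OF x] h[OF x] h1[OF x]] hD[OF x] by simp
  have ln4: "ln 4 = 2 * ln (2::real)"
    using ln_powr[of 2 2] by (simp add: ln_realpow[of 2 2, simplified])
  define t where "t = nat \<lceil>(D + ln 4) / (2 * g)\<rceil>"
  have q0: "0 \<le> (D + ln 4) / (2 * g)" using D0 g0 by simp
  have t1: "(D + ln 4) / (2 * g) \<le> t" unfolding t_def by linarith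
  then have tt: "D + ln 4 \<le> 2 * g * t" using g0 by (simp add: field_simps)
  have t2: "t \<le> (D + ln 4) / (2 * g) + 1" unfolding t_def using q0 by linarith
  have "ln (card G) \<le> 2 * (t * D + 1)"
    by (rule decoding_bound[where M=M and N=N and W=W and h=h and k=k and K=K and \<epsilon>=\<epsilon>])
      (fact assms tt[unfolded g_def])+
  moreover have "t * D \<le> ((D + ln 4) / (2 * g) + 1) * D" using t2 D0 by (rule mult_right_mono)
  ultimately have "ln (card G) - 2 \<le> 2 * (((D + ln 4) / (2 * g) + 1) * D)" by simp
  then have "g * (ln (card G) - 2) \<le> g * (2 * (((D + ln 4) / (2 * g) + 1) * D))"
    using g0 by (intro mult_left_mono) auto
  also have "\<dots> = D * D + (ln 4 + 2 * g) * D" using g0 by (simp add: field_simps)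
  \<comment> \<open>Here \<open>ln 4\<close> is below 1.39 and \<open>2 * g\<close> is at most
    \<open>1/2\<close>, together less than 2. The rounding up of \<open>t\<close> is thereby
    absorbed into the square of \<open>D + 1\<close>.\<close>
  also have "\<dots> \<le> D * D + 2 * D"
    using ln2_le_25_over_36 g1 D0 ln4 by (intro add_left_mono mult_right_mono) auto
  also have "\<dots> \<le> (D + 1)\<^sup>2" by (simp add: power2_eq_square algebra_simps)
  finally show ?thesis by (simp add: g_def)
qed

text \<open>With \<open>u\<close> equal to \<open>1/2 - \<epsilon>\<close> times
  \<open>sqrt n\<close>, the hypothesis makes \<open>2 * L\<close> about \<open>0.81 * u\<close> or
  more, whereas the claim asks for no more than about \<open>0.7 * u\<close>. The additive constants
  are absorbed by the 20 subtracted through \<open>g1\<close>. For \<open>n = 0\<close> the left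
  side of the hypothesis is negative, but then \<open>u = 0\<close> and the claimed bound is
  negative too.\<close>

lemma leakage_numeric_bound:
  fixes n :: nat and \<epsilon> \<delta>\<^sub>1 \<delta>\<^sub>2 L :: real
  assumes \<epsilon>: "\<epsilon> \<ge> 0" and \<delta>: "\<delta>\<^sub>1 > 0" "\<delta>\<^sub>2 > 0" "\<epsilon> + \<delta>\<^sub>1 + \<delta>\<^sub>2 < 1 / 2"
    and L0: "0 \<le> L"
    and L: "(1 / 2 - \<epsilon>)\<^sup>2 * ((real n - 1) * ln 2 - 2) \<le> (2 * L + 1)\<^sup>2"
  shows "\<delta>\<^sub>1 * (2 * sqrt (g3 (\<epsilon> + \<delta>\<^sub>1 + \<delta>\<^sub>2)) * sqrt (real n)
                  - g3 (\<epsilon> + \<delta>\<^sub>1 + \<delta>\<^sub>2) - g2 (real n) (real n) \<delta>\<^sub>2 - 10)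
           - 2 * g1 (2 * real n) \<le> L / ln 2"
proof -
  define \<gamma> where "\<gamma> = 1 / 2 - \<epsilon>"
  define \<gamma>' where "\<gamma>' = 1 / 2 - (\<epsilon> + \<delta>\<^sub>1 + \<delta>\<^sub>2)"
  have \<gamma>: "0 < \<gamma>'" "\<gamma>' \<le> \<gamma> - \<delta>\<^sub>1" "\<gamma> \<le> 1 / 2" "0 < \<gamma>"
    using \<epsilon> \<delta> by (auto simp: \<gamma>_def \<gamma>'_def)
  have l2: "2 / 3 \<le> ln (2::real)" "ln (2::real) \<le> 4 / 5"
    using ln2_ge_two_thirds ln2_le_25_over_36 by auto
  have le: "log 2 (exp 1) = 1 / ln 2" by (simp add: log_def)
  \<comment> \<open>From \<open>ln 2 \<ge> 2/3\<close> the radicand is at most 3, below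
    \<open>49/16\<close>.\<close>
  have "sqrt (2 * (1 / ln 2)) \<le> sqrt ((7 / 4)\<^sup>2)"
    using l2 by (intro real_sqrt_le_mono) (simp add: field_simps power2_eq_square)
  then have s: "sqrt (2 * (1 / ln 2)) \<le> 7 / 4" by simp
  have "sqrt (g3 (\<epsilon> + \<delta>\<^sub>1 + \<delta>\<^sub>2)) = \<gamma>' * sqrt (2 * (1 / ln 2))"
    unfolding g3_def le \<gamma>'_def[symmetric] using \<gamma>
    by (simp add: real_sqrt_mult real_sqrt_divide)
  also have "\<dots> \<le> (\<gamma> - \<delta>\<^sub>1) * (7 / 4)" using \<gamma> s \<delta> by (intro mult_mono) auto
  finally have sq: "sqrt (g3 (\<epsilon> + \<delta>\<^sub>1 + \<delta>\<^sub>2)) \<le> (\<gamma> - \<delta>\<^sub>1) * (7 / 4)" .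
  have g3: "0 \<le> g3 (\<epsilon> + \<delta>\<^sub>1 + \<delta>\<^sub>2)" unfolding g3_def le by simp
  have "1 \<le> 2 * (real n + real n) / (\<delta>\<^sub>2\<^sup>2 * (1 / ln 2)) + 1" by simp
  then have "0 \<le> log 2 (2 * (real n + real n) / (\<delta>\<^sub>2\<^sup>2 * (1 / ln 2)) + 1)"
    by (subst zero_le_log_cancel_iff) linarith+
  then have g2: "0 \<le> g2 (real n) (real n) \<delta>\<^sub>2" unfolding g2_def le by linarith
  have g1: "10 \<le> g1 (2 * real n)" unfolding g1_def by simp
  define u where "u = \<gamma> * sqrt n"
  have u0: "0 \<le> u" unfolding u_def using \<gamma> by simp
  have u2: "u\<^sup>2 = \<gamma>\<^sup>2 * n" unfolding u_def by (simp add: power_mult_distrib)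
  \<comment> \<open>The product is largest at half of \<open>\<gamma>\<close>. Since
    \<open>\<gamma> \<le> 1/2\<close>, one factor \<open>\<gamma>\<close> can be traded for
    \<open>1/2\<close>, leaving a multiple of \<open>\<gamma>\<close> that combines with
    \<open>sqrt n\<close> into \<open>u\<close>.\<close>
  have "\<delta>\<^sub>1 * (\<gamma> - \<delta>\<^sub>1) \<le> \<gamma>\<^sup>2 / 4" by (rule mult_const_minus_self_real_le)
  also have "\<dots> \<le> \<gamma> / 8" using \<gamma> by (simp add: power2_eq_square)
  finally have d: "\<delta>\<^sub>1 * (\<gamma> - \<delta>\<^sub>1) \<le> \<gamma> / 8" .
  have "\<delta>\<^sub>1 * (2 * sqrt (g3 (\<epsilon> + \<delta>\<^sub>1 + \<delta>\<^sub>2)) * sqrt (real n)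
                  - g3 (\<epsilon> + \<delta>\<^sub>1 + \<delta>\<^sub>2) - g2 (real n) (real n) \<delta>\<^sub>2 - 10) - 2 * g1 (2 * real n)
      \<le> \<delta>\<^sub>1 * (2 * ((\<gamma> - \<delta>\<^sub>1) * (7 / 4)) * sqrt (real n)) - 20"
  proof -
    have "2 * sqrt (g3 (\<epsilon> + \<delta>\<^sub>1 + \<delta>\<^sub>2)) * sqrt (real n) \<le> 2 * ((\<gamma> - \<delta>\<^sub>1) * (7 / 4)) * sqrt (real n)"
      using sq by (intro mult_right_mono mult_left_mono) auto
    then have "2 * sqrt (g3 (\<epsilon> + \<delta>\<^sub>1 + \<delta>\<^sub>2)) * sqrt (real n) - g3 (\<epsilon> + \<delta>\<^sub>1 + \<delta>\<^sub>2)
        - g2 (real n) (real n) \<delta>\<^sub>2 - 10 \<le> 2 * ((\<gamma> - \<delta>\<^sub>1) * (7 / 4)) * sqrt (real n)"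
      using g3 g2 by linarith
    from mult_left_mono[OF this less_imp_le[OF \<delta>(1)]] g1 show ?thesis by linarith
  qed
  also have "\<dots> = (\<delta>\<^sub>1 * (\<gamma> - \<delta>\<^sub>1)) * (7 / 2 * sqrt n) - 20" by (simp add: field_simps)
  also have "\<dots> \<le> \<gamma> / 8 * (7 / 2 * sqrt n) - 20"
    using d by (intro diff_right_mono mult_right_mono) auto
  also have "\<dots> = 7 / 16 * u - 20" by (simp add: u_def)
  also have "\<dots> \<le> 5 / 4 * L"
  proof (rule ccontr)
    assume "\<not> 7 / 16 * u - 20 \<le> 5 / 4 * L"
    \<comment> \<open>This is the negated claim times \<open>8/5\<close>. After squaring, the
      coefficient \<open>49/100\<close> of the square of \<open>u\<close> is beaten by the
      \<open>2/3\<close> coming from \<open>ln 2\<close>, and for \<open>u \<ge> 44\<close> the term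
      \<open>217/5 * u\<close> outweighs the constants 961 and 3.\<close>
    then have c: "2 * L + 1 < 7 / 10 * u - 31" by simp
    then have u: "44 \<le> u" using L0 by simp
    have "(2 * L + 1)\<^sup>2 \<le> (7 / 10 * u - 31)\<^sup>2" using c L0 by (intro power_mono) auto
    also have "\<dots> = 49 / 100 * u\<^sup>2 - 217 / 5 * u + 961" by (simp add: power2_eq_square algebra_simps)
    finally have 1: "(2 * L + 1)\<^sup>2 \<le> 49 / 100 * u\<^sup>2 - 217 / 5 * u + 961" .
    have "real n * (2 / 3) - 3 \<le> (real n - 1) * ln 2 - 2"
      using mult_left_mono[OF l2(1), of "real n"] l2(2) by (simp add: algebra_simps)
    then have "\<gamma>\<^sup>2 * (real n * (2 / 3) - 3) \<le> (2 * L + 1)\<^sup>2"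
      using L order_trans mult_left_mono[of "real n * (2 / 3) - 3" "(real n - 1) * ln 2 - 2" "\<gamma>\<^sup>2"]
      by (auto simp: \<gamma>_def)
    then have "2 / 3 * u\<^sup>2 - 3 * \<gamma>\<^sup>2 \<le> (2 * L + 1)\<^sup>2" by (simp add: u2 algebra_simps)
    moreover have "\<gamma>\<^sup>2 \<le> 1" using \<gamma> by (intro power_le_one) auto
    moreover have "0 \<le> u\<^sup>2" by simp
    ultimately show False using 1 u by linarith
  qed
  also have "\<dots> \<le> L / ln 2"
    using l2 L0 mult_left_mono[OF l2(2), of L] by (simp add: field_simps)
  finally show ?thesis .
qed

section \<open>Message densities of a protocol\<close>

text \<open>Brings together each player's private string and the string shared with the referee, and
  puts the referee's private string innermost, so that each player can be integrated separately.
  Three exchanges of neighbouring integrals suffice.\<close>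

lemma nn_integral_shuffle:
  fixes F :: "'a \<times> 'b \<times> 'c \<times> 'd \<times> 'e \<Rightarrow> ennreal"
  assumes "sigma_finite_measure A" "sigma_finite_measure B" "sigma_finite_measure C"
    "sigma_finite_measure D" "sigma_finite_measure E"
    and F[measurable]: "F \<in> borel_measurable (A \<Otimes>\<^sub>M B \<Otimes>\<^sub>M C \<Otimes>\<^sub>M D \<Otimes>\<^sub>M E)"
  shows "(\<integral>\<^sup>+p. F p \<partial>(A \<Otimes>\<^sub>M B \<Otimes>\<^sub>M C \<Otimes>\<^sub>M D \<Otimes>\<^sub>M E))
    = (\<integral>\<^sup>+a. \<integral>\<^sup>+d. \<integral>\<^sup>+b. \<integral>\<^sup>+e. \<integral>\<^sup>+c. F (a, b, c, d, e) \<partial>C \<partial>E \<partial>B \<partial>D \<partial>A)"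
proof -
  interpret A: sigma_finite_measure A by fact
  interpret B: sigma_finite_measure B by fact
  interpret C: sigma_finite_measure C by fact
  interpret D: sigma_finite_measure D by fact
  interpret E: sigma_finite_measure E by fact
  interpret DE: pair_sigma_finite D E ..
  interpret CDE: pair_sigma_finite C "D \<Otimes>\<^sub>M E" ..
  interpret BCDE: pair_sigma_finite B "C \<Otimes>\<^sub>M D \<Otimes>\<^sub>M E" ..
  interpret CD: pair_sigma_finite C D ..
  interpret BD: pair_sigma_finite B D ..
  interpret CE: pair_sigma_finite C E ..
  have "(\<integral>\<^sup>+p. F p \<partial>(A \<Otimes>\<^sub>M B \<Otimes>\<^sub>M C \<Otimes>\<^sub>M D \<Otimes>\<^sub>M E))
    = (\<integral>\<^sup>+a. \<integral>\<^sup>+b. \<integral>\<^sup>+c. \<integral>\<^sup>+d. \<integral>\<^sup>+e. F (a, b, c, d, e) \<partial>E \<partial>D \<partial>C \<partial>B \<partial>A)"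
    by (simp add: BCDE.nn_integral_fst[symmetric] CDE.nn_integral_fst[symmetric]
      DE.nn_integral_fst[symmetric] E.nn_integral_fst[symmetric] cong: nn_integral_cong)
  also have "\<dots> = (\<integral>\<^sup>+a. \<integral>\<^sup>+b. \<integral>\<^sup>+d. \<integral>\<^sup>+c. \<integral>\<^sup>+e. F (a, b, c, d, e) \<partial>E \<partial>C \<partial>D \<partial>B \<partial>A)"
    by (intro nn_integral_cong CD.Fubini'[symmetric]) measurable
  also have "\<dots> = (\<integral>\<^sup>+a. \<integral>\<^sup>+d. \<integral>\<^sup>+b. \<integral>\<^sup>+c. \<integral>\<^sup>+e. F (a, b, c, d, e) \<partial>E \<partial>C \<partial>B \<partial>D \<partial>A)"
    by (intro nn_integral_cong BD.Fubini'[symmetric]) measurable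
  also have "\<dots> = (\<integral>\<^sup>+a. \<integral>\<^sup>+d. \<integral>\<^sup>+b. \<integral>\<^sup>+e. \<integral>\<^sup>+c. F (a, b, c, d, e) \<partial>C \<partial>E \<partial>B \<partial>D \<partial>A)"
    by (intro nn_integral_cong CE.Fubini'[symmetric]) measurable
  finally show ?thesis .
qed

text \<open>Since \<open>Ms\<close> is finite, joint measurability can be checked one message at a
  time, where the function is the measure of a section of a measurable set.\<close>

lemma measurable_message_density:
  assumes R: "prob_space R" and S: "sigma_finite_measure S" and fin: "finite Ms"
    and f: "(\<lambda>(r, s). f r s) \<in> R \<Otimes>\<^sub>M S \<rightarrow>\<^sub>M count_space Ms"
  shows "(\<lambda>p. measure R {r\<in>space R. f r (snd p) = fst p}) \<in> borel_measurable (count_space Ms \<Otimes>\<^sub>M S)"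
proof (rule measurable_pair_measure_countable1)
  interpret R: prob_space R by fact
  fix m assume "m \<in> Ms"
  have "(\<lambda>p. f (snd p) (fst p)) \<in> S \<Otimes>\<^sub>M R \<rightarrow>\<^sub>M count_space Ms"
    using measurable_compose[OF measurable_pair_swap' f] by (simp add: split_beta')
  from measurable_sets[OF this, of "{m}"] \<open>m \<in> Ms\<close>
  have "{p\<in>space (S \<Otimes>\<^sub>M R). f (snd p) (fst p) = m} \<in> sets (S \<Otimes>\<^sub>M R)"
    by (simp add: vimage_def Int_def conj_commute)
  then have "(\<lambda>s. measure R (Pair s -` {p\<in>space (S \<Otimes>\<^sub>M R). f (snd p) (fst p) = m})) \<in> borel_measurable S"
    unfolding measure_def by (intro borel_measurable_enn2real R.measurable_emeasure_Pair)
  also have "?this \<longleftrightarrow> (\<lambda>s. measure R {r\<in>space R. f r s = m}) \<in> borel_measurable S"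
    by (intro measurable_cong arg_cong[where f="measure R"]) (auto simp: space_pair_measure)
  finally show "(\<lambda>s. measure R {r\<in>space R. f r (snd (m, s)) = fst (m, s)}) \<in> borel_measurable S"
    by simp
qed (use fin in \<open>auto intro: countable_finite\<close>)

text \<open>For a fixed shared string \<open>s\<close>, the private string matters only through the
  message it produces. So the pair of message and shared string has the message probability as its
  density relative to counting measure times the law of \<open>s\<close>.\<close>

lemma nn_integral_message:
  fixes \<Phi> :: "'m \<times> 's \<Rightarrow> ennreal"
  assumes R: "prob_space R" and S: "sigma_finite_measure S" and fin: "finite Ms"
    and f: "(\<lambda>(r, s). f r s) \<in> R \<Otimes>\<^sub>M S \<rightarrow>\<^sub>M count_space Ms"
    and \<Phi>: "\<Phi> \<in> borel_measurable (count_space Ms \<Otimes>\<^sub>M S)"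
  shows "(\<integral>\<^sup>+r. \<integral>\<^sup>+s. \<Phi> (f r s, s) \<partial>S \<partial>R) =
    (\<integral>\<^sup>+m. \<integral>\<^sup>+s. ennreal (measure R {r\<in>space R. f r s = m}) * \<Phi> (m, s) \<partial>S \<partial>count_space Ms)"
proof -
  interpret R: prob_space R by fact
  interpret S: sigma_finite_measure S by fact
  interpret RS: pair_sigma_finite R S ..
  have fm[measurable]: "(\<lambda>p. f (fst p) (snd p)) \<in> R \<Otimes>\<^sub>M S \<rightarrow>\<^sub>M count_space Ms"
    using f by (simp add: split_beta')
  note \<Phi>[measurable]
  have \<Phi>m[measurable]: "(\<lambda>s. \<Phi> (m, s)) \<in> borel_measurable S" if "m \<in> Ms" for m
    using measurable_compose[OF measurable_Pair1'[of m "count_space Ms"] \<Phi>] that by simp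
  have "(\<integral>\<^sup>+r. \<integral>\<^sup>+s. \<Phi> (f r s, s) \<partial>S \<partial>R) = (\<integral>\<^sup>+s. \<integral>\<^sup>+r. \<Phi> (f r s, s) \<partial>R \<partial>S)"
    by (intro RS.Fubini'[symmetric]) (simp add: split_beta')
  also have "\<dots> = (\<integral>\<^sup>+s. (\<Sum>m\<in>Ms. ennreal (measure R {r\<in>space R. f r s = m}) * \<Phi> (m, s)) \<partial>S)"
  proof (rule nn_integral_cong)
    fix s assume s: "s \<in> space S"
    have fs: "(\<lambda>r. f r s) \<in> R \<rightarrow>\<^sub>M count_space Ms"
      using measurable_compose[OF measurable_Pair2'[OF s] fm] by simp
    have sets: "{r\<in>space R. f r s = m} \<in> sets R" if "m \<in> Ms" for m
      using measurable_sets[OF fs, of "{m}"] that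
      by (simp add: vimage_def Int_def conj_commute)
    have "(\<integral>\<^sup>+r. \<Phi> (f r s, s) \<partial>R)
      = (\<integral>\<^sup>+r. (\<Sum>m\<in>Ms. \<Phi> (m, s) * indicator {r\<in>space R. f r s = m} r) \<partial>R)"
    proof (rule nn_integral_cong)
      fix r assume r: "r \<in> space R"
      then have "f r s \<in> Ms" using measurable_space[OF fs] by simp
      then show "\<Phi> (f r s, s) = (\<Sum>m\<in>Ms. \<Phi> (m, s) * indicator {r\<in>space R. f r s = m} r)"
        using fin r by (simp add: indicator_def if_distrib cong: if_cong)
    qed
    also have "\<dots> = (\<Sum>m\<in>Ms. \<Phi> (m, s) * emeasure R {r\<in>space R. f r s = m})"
      using sets by (subst nn_integral_sum) (auto simp: nn_integral_cmult_indicator)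
    finally show "(\<integral>\<^sup>+r. \<Phi> (f r s, s) \<partial>R)
        = (\<Sum>m\<in>Ms. ennreal (measure R {r\<in>space R. f r s = m}) * \<Phi> (m, s))"
      by (simp add: R.emeasure_eq_measure mult.commute)
  qed
  also have "\<dots> = (\<Sum>m\<in>Ms. \<integral>\<^sup>+s. ennreal (measure R {r\<in>space R. f r s = m}) * \<Phi> (m, s) \<partial>S)"
  proof (rule nn_integral_sum)
    fix m assume m: "m \<in> Ms"
    have "(\<lambda>s. measure R {r\<in>space R. f r s = m}) \<in> borel_measurable S"
      using measurable_compose[OF measurable_Pair1'[of m "count_space Ms" S] measurable_message_density[OF R S fin f]] m by simp
    then show "(\<lambda>s. ennreal (measure R {r\<in>space R. f r s = m}) * \<Phi> (m, s)) \<in> borel_measurable S"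
      using m by measurable
  qed
  also have "\<dots> = (\<integral>\<^sup>+m. \<integral>\<^sup>+s. ennreal (measure R {r\<in>space R. f r s = m}) * \<Phi> (m, s) \<partial>S \<partial>count_space Ms)"
    using fin by (simp add: nn_integral_count_space_finite)
  finally show ?thesis .
qed

text \<open>
  A string shared with the referee may as well be drawn by its owner and sent along. So a protocol is
  a private-coin one with messages \<open>(ma, rac)\<close> and \<open>(mb, rbc)\<close>, the views below; \<open>pA x\<close> and \<open>pB y\<close>
  are their densities.
\<close>

locale equality_protocol =
  fixes P :: "('x, 'x, bool, 'r, 'm) smp_protocol" and S :: "'x set" and \<epsilon> :: real
  assumes protocol: "smp_protocol_on S S P"
    and finite_S: "finite S" and S_nonempty: "S \<noteq> {}"
    and correct: "computes_with_error S S P (=) \<epsilon>"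
begin

abbreviation (input) NA :: "('m \<times> 'r) measure" where "NA \<equiv> count_space (MA P) \<Otimes>\<^sub>M RAC P"

abbreviation (input) NB :: "('m \<times> 'r) measure" where "NB \<equiv> count_space (MB P) \<Otimes>\<^sub>M RBC P"

text \<open>The codomain measure in \<open>information_leakage_dist\<close>. It is in general no
  probability measure, because of the counting factors, but it is finite, so bounded measurable
  functions are integrable.\<close>

definition T :: "('m \<times> 'm \<times> 'r \<times> 'r \<times> 'r) measure" where
  "T = count_space (MA P) \<Otimes>\<^sub>M count_space (MB P) \<Otimes>\<^sub>M RC P \<Otimes>\<^sub>M RAC P \<Otimes>\<^sub>M RBC P"

definition viewA :: "'m \<times> 'm \<times> 'r \<times> 'r \<times> 'r \<Rightarrow> 'm \<times> 'r" where
  "viewA = (\<lambda>(ma, mb, rc, rac, rbc). (ma, rac))"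

definition viewB :: "'m \<times> 'm \<times> 'r \<times> 'r \<times> 'r \<Rightarrow> 'm \<times> 'r" where
  "viewB = (\<lambda>(ma, mb, rc, rac, rbc). (mb, rbc))"

definition pA :: "'x \<Rightarrow> 'm \<times> 'r \<Rightarrow> real" where
  "pA x a = measure (RA P) {r\<in>space (RA P). PA P x r (snd a) = fst a}"

definition pB :: "'x \<Rightarrow> 'm \<times> 'r \<Rightarrow> real" where
  "pB y b = measure (RB P) {r\<in>space (RB P). PB P y r (snd b) = fst b}"

text \<open>The referee's private string is averaged out here, which turns the referee into a kernel
  on pairs of views with values in the unit interval: the \<open>W\<close> of the decoding
  bound.\<close>

definition accept :: "'m \<times> 'r \<Rightarrow> 'm \<times> 'r \<Rightarrow> real" where
  "accept a b = measure (RC P) {rc\<in>space (RC P). PC P (fst a) (fst b) rc (snd a) (snd b)}"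

lemma prob_spaces:
  "prob_space (RA P)" "prob_space (RB P)" "prob_space (RC P)" "prob_space (RAC P)" "prob_space (RBC P)"
  using protocol by (auto simp: smp_protocol_on_def)

lemma finite_messages: "finite (MA P)" "finite (MB P)"
  using protocol by (auto simp: smp_protocol_on_def)

lemma measurable_PA: "x \<in> S \<Longrightarrow> (\<lambda>(ra, rac). PA P x ra rac) \<in> RA P \<Otimes>\<^sub>M RAC P \<rightarrow>\<^sub>M count_space (MA P)"
  and measurable_PB: "y \<in> S \<Longrightarrow> (\<lambda>(rb, rbc). PB P y rb rbc) \<in> RB P \<Otimes>\<^sub>M RBC P \<rightarrow>\<^sub>M count_space (MB P)"
  and measurable_PC: "ma \<in> MA P \<Longrightarrow> mb \<in> MB P \<Longrightarrow> (\<lambda>(rc, rac, rbc). PC P ma mb rc rac rbc)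
        \<in> RC P \<Otimes>\<^sub>M RAC P \<Otimes>\<^sub>M RBC P \<rightarrow>\<^sub>M count_space UNIV"
  using protocol by (auto simp: smp_protocol_on_def)

sublocale RA: prob_space "RA P" by (rule prob_spaces)
sublocale RB: prob_space "RB P" by (rule prob_spaces)
sublocale RC: prob_space "RC P" by (rule prob_spaces)
sublocale RAC: prob_space "RAC P" by (rule prob_spaces)
sublocale RBC: prob_space "RBC P" by (rule prob_spaces)
sublocale cA: finite_measure "count_space (MA P)"
  by (intro finite_measure_count_space finite_messages)
sublocale cB: finite_measure "count_space (MB P)"
  by (intro finite_measure_count_space finite_messages)
sublocale NA: finite_measure NA
  by (intro finite_measure_pair_measure cA.finite_measure_axioms RAC.finite_measure_axioms)
sublocale NB: finite_measure NB
  by (intro finite_measure_pair_measure cB.finite_measure_axioms RBC.finite_measure_axioms)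
sublocale T: finite_measure T
  unfolding T_def
  by (intro finite_measure_pair_measure cA.finite_measure_axioms cB.finite_measure_axioms
      RAC.finite_measure_axioms RBC.finite_measure_axioms RC.finite_measure_axioms)

lemma measurable_viewA[measurable]: "viewA \<in> T \<rightarrow>\<^sub>M NA"
  unfolding viewA_def T_def by measurable

lemma measurable_viewB[measurable]: "viewB \<in> T \<rightarrow>\<^sub>M NB"
  unfolding viewB_def T_def by measurable

lemma measurable_pA[measurable]: "x \<in> S \<Longrightarrow> pA x \<in> borel_measurable NA"
  unfolding pA_def
  by (intro measurable_message_density RAC.sigma_finite_measure_axioms prob_spaces finite_messages measurable_PA)

lemma measurable_pB[measurable]: "y \<in> S \<Longrightarrow> pB y \<in> borel_measurable NB"
  unfolding pB_def
  by (intro measurable_message_density RBC.sigma_finite_measure_axioms prob_spaces finite_messages measurable_PB)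

lemma pA_bounds: "0 \<le> pA x a" "pA x a \<le> 1"
  and pB_bounds: "0 \<le> pB x a" "pB x a \<le> 1"
  and accept_bounds: "0 \<le> accept a b" "accept a b \<le> 1"
  by (auto simp: pA_def pB_def accept_def)

lemma measurable_PC_T:
  "(\<lambda>(ma, mb, rc, rac, rbc). PC P ma mb rc rac rbc) \<in> T \<rightarrow>\<^sub>M count_space UNIV"
  unfolding T_def
proof (rule measurable_pair_measure_countable1)
  fix ma assume ma: "ma \<in> MA P"
  have "(\<lambda>(mb, rc, rac, rbc). PC P ma mb rc rac rbc)
      \<in> count_space (MB P) \<Otimes>\<^sub>M RC P \<Otimes>\<^sub>M RAC P \<Otimes>\<^sub>M RBC P \<rightarrow>\<^sub>M count_space UNIV"
    by (rule measurable_pair_measure_countable1)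
      (use measurable_PC[OF ma] finite_messages in \<open>auto intro: countable_finite\<close>)
  then show "(\<lambda>y. case (ma, y) of (ma, mb, rc, rac, rbc) \<Rightarrow> PC P ma mb rc rac rbc)
      \<in> count_space (MB P) \<Otimes>\<^sub>M RC P \<Otimes>\<^sub>M RAC P \<Otimes>\<^sub>M RBC P \<rightarrow>\<^sub>M count_space UNIV"
    by simp
qed (use finite_messages in \<open>auto intro: countable_finite\<close>)

lemma sets_RC_accept:
  assumes "a \<in> space NA" "b \<in> space NB"
  shows "{rc\<in>space (RC P). PC P (fst a) (fst b) rc (snd a) (snd b)} \<in> sets (RC P)"
proof -
  have "fst a \<in> MA P" "fst b \<in> MB P" and r: "snd a \<in> space (RAC P)" "snd b \<in> space (RBC P)"
    using assms by (auto simp: space_pair_measure)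
  from measurable_PC[OF this(1,2)]
  have m: "(\<lambda>p. PC P (fst a) (fst b) (fst p) (fst (snd p)) (snd (snd p)))
      \<in> RC P \<Otimes>\<^sub>M RAC P \<Otimes>\<^sub>M RBC P \<rightarrow>\<^sub>M count_space UNIV"
    by (simp add: split_beta')
  have "(\<lambda>rc. (rc, snd a, snd b)) \<in> RC P \<rightarrow>\<^sub>M RC P \<Otimes>\<^sub>M RAC P \<Otimes>\<^sub>M RBC P"
    using r by measurable
  from measurable_compose[OF this m]
  have "Measurable.pred (RC P) (\<lambda>rc. PC P (fst a) (fst b) rc (snd a) (snd b))"
    by simp
  then show ?thesis by (simp add: pred_def)
qed

text \<open>There are finitely many message pairs. For a fixed pair the value is the measure of a
  section, measurable in the two shared strings; the pieces are then glued together.\<close>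

lemma measurable_accept: "(\<lambda>p. accept (fst p) (snd p)) \<in> borel_measurable (NA \<Otimes>\<^sub>M NB)"
proof -
  define g where "g = (\<lambda>(ma, mb) s. measure (RC P) {rc\<in>space (RC P). PC P ma mb rc (fst s) (snd s)})"
  have g: "g m \<in> borel_measurable (RAC P \<Otimes>\<^sub>M RBC P)" if "m \<in> MA P \<times> MB P" for m
  proof -
    obtain ma mb where m: "m = (ma, mb)" "ma \<in> MA P" "mb \<in> MB P"
      using \<open>m \<in> MA P \<times> MB P\<close> by auto
    let ?S = "RAC P \<Otimes>\<^sub>M RBC P"
    have "(\<lambda>p. PC P ma mb (snd p) (fst (fst p)) (snd (fst p))) \<in> ?S \<Otimes>\<^sub>M RC P \<rightarrow>\<^sub>M count_space UNIV"
      using measurable_compose[OF measurable_pair_swap' measurable_PC[OF m(2,3)]]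
      by (simp add: split_beta')
    then have s: "{p\<in>space (?S \<Otimes>\<^sub>M RC P). PC P ma mb (snd p) (fst (fst p)) (snd (fst p))} \<in> sets (?S \<Otimes>\<^sub>M RC P)"
      by (simp add: pred_def)
    have "(\<lambda>s. measure (RC P) (Pair s -`
        {p\<in>space (?S \<Otimes>\<^sub>M RC P). PC P ma mb (snd p) (fst (fst p)) (snd (fst p))})) \<in> borel_measurable ?S"
      unfolding measure_def by (intro borel_measurable_enn2real RC.measurable_emeasure_Pair s)
    also have "?this \<longleftrightarrow> g m \<in> borel_measurable ?S"
      by (intro measurable_cong) (auto simp: g_def m space_pair_measure intro!: arg_cong[where f="measure (RC P)"])
    finally show ?thesis .
  qed
  have "(\<lambda>p. g (fst (fst p), fst (snd p)) (snd (fst p), snd (snd p))) \<in> borel_measurable (NA \<Otimes>\<^sub>M NB)"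
  proof (rule measurable_compose_countable'[where I="MA P \<times> MB P"
        and f="\<lambda>m p. g m (snd (fst p), snd (snd p))" and g="\<lambda>p. (fst (fst p), fst (snd p))"])
    show "(\<lambda>p. g m (snd (fst p), snd (snd p))) \<in> borel_measurable (NA \<Otimes>\<^sub>M NB)"
      if "m \<in> MA P \<times> MB P" for m
      by (rule measurable_compose[OF _ g[OF that]]) measurable
    have "(\<lambda>p. (fst (fst p), fst (snd p))) \<in> NA \<Otimes>\<^sub>M NB \<rightarrow>\<^sub>M count_space (MA P) \<Otimes>\<^sub>M count_space (MB P)"
      by measurable
    then show "(\<lambda>p. (fst (fst p), fst (snd p))) \<in> NA \<Otimes>\<^sub>M NB \<rightarrow>\<^sub>M count_space (MA P \<times> MB P)"
      using finite_messages by (simp add: pair_measure_count_space)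
  qed (use finite_messages in \<open>auto intro: countable_finite\<close>)
  then show ?thesis by (simp add: g_def accept_def)
qed

section \<open>Transcript law for fixed inputs\<close>

lemma measurable_transcript:
  assumes "x \<in> S" "y \<in> S"
  shows "(\<lambda>r. transcript P ((x, y), r)) \<in> randomness P \<rightarrow>\<^sub>M T"
proof -
  note measurable_compose[OF _ measurable_PA[OF assms(1)], measurable]
    measurable_compose[OF _ measurable_PB[OF assms(2)], measurable]
  have "(\<lambda>(ra, rb, rc, rac, rbc). (case (ra, rac) of (ra, rac) \<Rightarrow> PA P x ra rac,
      case (rb, rbc) of (rb, rbc) \<Rightarrow> PB P y rb rbc, rc, rac, rbc)) \<in> randomness P \<rightarrow>\<^sub>M T"
    unfolding randomness_def T_def by measurable
  then show ?thesis by (simp add: transcript_def split_beta')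
qed

text \<open>For fixed inputs the two views are independent, because Alice and Bob share no
  randomness. So the transcript density is the product of the two view densities.\<close>

lemma nn_integral_transcript:
  fixes G :: "_ \<Rightarrow> ennreal"
  assumes x: "x \<in> S" and y: "y \<in> S" and G: "G \<in> borel_measurable T"
  shows "(\<integral>\<^sup>+r. G (transcript P ((x, y), r)) \<partial>randomness P)
    = (\<integral>\<^sup>+\<tau>. ennreal (pA x (viewA \<tau>) * pB y (viewB \<tau>)) * G \<tau> \<partial>T)"
proof -
  note G'[measurable] = G[unfolded T_def]
  note measurable_pA[OF x, measurable] measurable_pB[OF y, measurable]
  \<comment> \<open>\<open>\<Psi>\<close> integrates out the referee's string and
    \<open>\<Phi>\<close> below also Bob's view. This makes \<open>nn_integral_message\<close>
    applicable to one player at a time, Bob inside and Alice outside.\<close>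
  define \<Psi> where "\<Psi> = (\<lambda>(ma, rac) (mb, rbc). \<integral>\<^sup>+rc. G (ma, mb, rc, rac, rbc) \<partial>RC P)"
  have \<Psi>m[measurable]: "(\<lambda>(a, b). \<Psi> a b) \<in> borel_measurable (NA \<Otimes>\<^sub>M NB)"
    unfolding \<Psi>_def split_beta' by measurable
  define \<Phi> where "\<Phi> = (\<lambda>a. \<integral>\<^sup>+b. ennreal (pB y b) * \<Psi> a b \<partial>NB)"
  have \<Phi>m[measurable]: "\<Phi> \<in> borel_measurable NA"
    unfolding \<Phi>_def by measurable
  have "(\<integral>\<^sup>+r. G (transcript P ((x, y), r)) \<partial>randomness P)
    = (\<integral>\<^sup>+ra. \<integral>\<^sup>+rac. \<integral>\<^sup>+rb. \<integral>\<^sup>+rbc. \<integral>\<^sup>+rc. G (transcript P ((x, y), (ra, rb, rc, rac, rbc)))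
        \<partial>RC P \<partial>RBC P \<partial>RB P \<partial>RAC P \<partial>RA P)"
    unfolding randomness_def
    using measurable_compose[OF measurable_transcript[OF x y] G, unfolded randomness_def]
    by (intro nn_integral_shuffle RA.sigma_finite_measure_axioms RB.sigma_finite_measure_axioms
      RC.sigma_finite_measure_axioms RAC.sigma_finite_measure_axioms RBC.sigma_finite_measure_axioms)
  also have "\<dots> = (\<integral>\<^sup>+ra. \<integral>\<^sup>+rac. \<integral>\<^sup>+rb. \<integral>\<^sup>+rbc. \<Psi> (PA P x ra rac, rac) (PB P y rb rbc, rbc)
        \<partial>RBC P \<partial>RB P \<partial>RAC P \<partial>RA P)"
    by (simp add: \<Psi>_def transcript_def)
  also have "\<dots> = (\<integral>\<^sup>+ra. \<integral>\<^sup>+rac. \<Phi> (PA P x ra rac, rac) \<partial>RAC P \<partial>RA P)"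
  proof (intro nn_integral_cong)
    fix ra rac assume r: "ra \<in> space (RA P)" "rac \<in> space (RAC P)"
    have "PA P x ra rac \<in> MA P"
      using measurable_space[OF measurable_PA[OF x], of "(ra, rac)"] r by (simp add: space_pair_measure)
    then have a: "(PA P x ra rac, rac) \<in> space NA" using r by (simp add: space_pair_measure)
    have \<Psi>a[measurable]: "\<Psi> (PA P x ra rac, rac) \<in> borel_measurable NB"
      using measurable_compose[OF measurable_Pair1'[OF a] \<Psi>m] by simp
    have "(\<integral>\<^sup>+rb. \<integral>\<^sup>+rbc. \<Psi> (PA P x ra rac, rac) (PB P y rb rbc, rbc) \<partial>RBC P \<partial>RB P)
      = (\<integral>\<^sup>+mb. \<integral>\<^sup>+rbc. ennreal (pB y (mb, rbc)) * \<Psi> (PA P x ra rac, rac) (mb, rbc)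
          \<partial>RBC P \<partial>count_space (MB P))"
      by (subst nn_integral_message[OF prob_spaces(2) RBC.sigma_finite_measure_axioms finite_messages(2) measurable_PB[OF y] \<Psi>a])
        (simp add: pB_def)
    also have "\<dots> = \<Phi> (PA P x ra rac, rac)"
      unfolding \<Phi>_def by (subst RBC.nn_integral_fst[symmetric]) auto
    finally show "(\<integral>\<^sup>+rb. \<integral>\<^sup>+rbc. \<Psi> (PA P x ra rac, rac) (PB P y rb rbc, rbc) \<partial>RBC P \<partial>RB P)
      = \<Phi> (PA P x ra rac, rac)" .
  qed
  also have "\<dots> = (\<integral>\<^sup>+ma. \<integral>\<^sup>+rac. ennreal (pA x (ma, rac)) * \<Phi> (ma, rac) \<partial>RAC P \<partial>count_space (MA P))"
    by (subst nn_integral_message[OF prob_spaces(1) RAC.sigma_finite_measure_axioms finite_messages(1) measurable_PA[OF x] \<Phi>m])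
      (simp add: pA_def)
  also have "\<dots> = (\<integral>\<^sup>+ma. \<integral>\<^sup>+rac. \<integral>\<^sup>+mb. \<integral>\<^sup>+rbc. \<integral>\<^sup>+rc.
      ennreal (pA x (ma, rac) * pB y (mb, rbc)) * G (ma, mb, rc, rac, rbc)
      \<partial>RC P \<partial>RBC P \<partial>count_space (MB P) \<partial>RAC P \<partial>count_space (MA P))"
  proof (intro nn_integral_cong)
    fix ma rac assume ma: "ma \<in> space (count_space (MA P))" and rac: "rac \<in> space (RAC P)"
    then have a: "(ma, rac) \<in> space NA" by (simp add: space_pair_measure)
    have \<Psi>a[measurable]: "\<Psi> (ma, rac) \<in> borel_measurable NB"
      using measurable_compose[OF measurable_Pair1'[OF a] \<Psi>m] by simp
    have "ennreal (pA x (ma, rac)) * \<Phi> (ma, rac)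
      = (\<integral>\<^sup>+b. ennreal (pA x (ma, rac) * pB y b) * \<Psi> (ma, rac) b \<partial>NB)"
      unfolding \<Phi>_def by (subst nn_integral_cmult[symmetric])
        (auto simp: ennreal_mult' pA_bounds mult.assoc)
    also have "\<dots> = (\<integral>\<^sup>+mb. \<integral>\<^sup>+rbc. ennreal (pA x (ma, rac) * pB y (mb, rbc)) * \<Psi> (ma, rac) (mb, rbc)
        \<partial>RBC P \<partial>count_space (MB P))"
      by (subst RBC.nn_integral_fst[symmetric]) auto
    also have "\<dots> = (\<integral>\<^sup>+mb. \<integral>\<^sup>+rbc. \<integral>\<^sup>+rc. ennreal (pA x (ma, rac) * pB y (mb, rbc)) * G (ma, mb, rc, rac, rbc)
        \<partial>RC P \<partial>RBC P \<partial>count_space (MB P))"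
      unfolding \<Psi>_def using ma rac by (intro nn_integral_cong) (simp add: nn_integral_cmult)
    finally show "ennreal (pA x (ma, rac)) * \<Phi> (ma, rac) = \<dots>" .
  qed
  also have "\<dots> = (\<integral>\<^sup>+\<tau>. ennreal (pA x (viewA \<tau>) * pB y (viewB \<tau>)) * G \<tau> \<partial>T)"
  proof -
    have "(\<lambda>\<tau>. ennreal (pA x (viewA \<tau>) * pB y (viewB \<tau>)) * G \<tau>) \<in> borel_measurable T"
      using G by measurable
    then show ?thesis
      unfolding T_def
      by (subst nn_integral_shuffle[OF cA.sigma_finite_measure_axioms cB.sigma_finite_measure_axioms
        RC.sigma_finite_measure_axioms RAC.sigma_finite_measure_axioms RBC.sigma_finite_measure_axioms])
        (auto simp: viewA_def viewB_def)
  qed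
  finally show ?thesis .
qed

text \<open>Up to reordering, \<open>T\<close> is the product of \<open>NA\<close>,
  \<open>NB\<close> and the law of the referee's private string, which has mass 1.\<close>

lemma nn_integral_views:
  fixes u v :: "'m \<times> 'r \<Rightarrow> ennreal"
  assumes [measurable]: "u \<in> borel_measurable NA" "v \<in> borel_measurable NB"
  shows "(\<integral>\<^sup>+\<tau>. u (viewA \<tau>) * v (viewB \<tau>) \<partial>T) = (\<integral>\<^sup>+a. u a \<partial>NA) * (\<integral>\<^sup>+b. v b \<partial>NB)"
proof -
  have "(\<lambda>\<tau>. u (viewA \<tau>) * v (viewB \<tau>)) \<in> borel_measurable T"
    by measurable
  then have "(\<integral>\<^sup>+\<tau>. u (viewA \<tau>) * v (viewB \<tau>) \<partial>T) = (\<integral>\<^sup>+ma. \<integral>\<^sup>+rac. \<integral>\<^sup>+mb. \<integral>\<^sup>+rbc. \<integral>\<^sup>+rc.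
      u (ma, rac) * v (mb, rbc) \<partial>RC P \<partial>RBC P \<partial>count_space (MB P) \<partial>RAC P \<partial>count_space (MA P))"
    unfolding T_def
    by (subst nn_integral_shuffle[OF cA.sigma_finite_measure_axioms cB.sigma_finite_measure_axioms
        RC.sigma_finite_measure_axioms RAC.sigma_finite_measure_axioms RBC.sigma_finite_measure_axioms])
      (auto simp: viewA_def viewB_def)
  also have "\<dots> = (\<integral>\<^sup>+ma. \<integral>\<^sup>+rac. \<integral>\<^sup>+b. u (ma, rac) * v b \<partial>NB \<partial>RAC P \<partial>count_space (MA P))"
    by (subst RBC.nn_integral_fst[symmetric]) (auto simp: RC.emeasure_space_1)
  also have "\<dots> = (\<integral>\<^sup>+a. \<integral>\<^sup>+b. u a * v b \<partial>NB \<partial>NA)"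
    by (subst RAC.nn_integral_fst[symmetric]) auto
  also have "\<dots> = (\<integral>\<^sup>+a. u a \<partial>NA) * (\<integral>\<^sup>+b. v b \<partial>NB)"
    by (simp add: nn_integral_cmult nn_integral_multc)
  finally show ?thesis .
qed

lemma nn_integral_pA:
  assumes "x \<in> S"
  shows "(\<integral>\<^sup>+a. ennreal (pA x a) \<partial>NA) = 1"
proof -
  note measurable_pA[OF assms, measurable]
  have "(\<integral>\<^sup>+a. ennreal (pA x a) \<partial>NA)
    = (\<integral>\<^sup>+m. \<integral>\<^sup>+s. ennreal (pA x (m, s)) * 1 \<partial>RAC P \<partial>count_space (MA P))"
    by (subst RAC.nn_integral_fst[symmetric]) auto
  also have "\<dots> = (\<integral>\<^sup>+r. \<integral>\<^sup>+s. 1 \<partial>RAC P \<partial>RA P)"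
    by (subst nn_integral_message[OF prob_spaces(1) RAC.sigma_finite_measure_axioms finite_messages(1) measurable_PA[OF assms], of "\<lambda>_. 1"])
      (auto simp: pA_def)
  finally show ?thesis by (simp add: RAC.emeasure_space_1 RA.emeasure_space_1)
qed

lemma nn_integral_pB:
  assumes "x \<in> S"
  shows "(\<integral>\<^sup>+a. ennreal (pB x a) \<partial>NB) = 1"
proof -
  note measurable_pB[OF assms, measurable]
  have "(\<integral>\<^sup>+a. ennreal (pB x a) \<partial>NB)
    = (\<integral>\<^sup>+m. \<integral>\<^sup>+s. ennreal (pB x (m, s)) * 1 \<partial>RBC P \<partial>count_space (MB P))"
    by (subst RBC.nn_integral_fst[symmetric]) auto
  also have "\<dots> = (\<integral>\<^sup>+r. \<integral>\<^sup>+s. 1 \<partial>RBC P \<partial>RB P)"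
    by (subst nn_integral_message[OF prob_spaces(2) RBC.sigma_finite_measure_axioms finite_messages(2) measurable_PB[OF assms], of "\<lambda>_. 1"])
      (auto simp: pB_def)
  finally show ?thesis by (simp add: RBC.emeasure_space_1 RB.emeasure_space_1)
qed

text \<open>Acceptance is an event of the transcript, so its probability follows from the transcript
  density; integrating the referee's private string first produces \<open>accept\<close>.\<close>

lemma emeasure_accept:
  assumes x: "x \<in> S" and y: "y \<in> S"
  shows "emeasure (randomness P) {r\<in>space (randomness P). smp_output P x y r}
    = (\<integral>\<^sup>+a. ennreal (pA x a) * (\<integral>\<^sup>+b. ennreal (pB y b * accept a b) \<partial>NB) \<partial>NA)"
    (is "?L = ?R")
    and "{r\<in>space (randomness P). smp_output P x y r} \<in> sets (randomness P)"
proof -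
  let ?out = "\<lambda>(ma, mb, rc, rac, rbc). PC P ma mb rc rac rbc"
  let ?A = "{\<tau>\<in>space T. ?out \<tau>}"
  have A[measurable]: "?A \<in> sets T"
    using measurable_PC_T by (simp add: pred_def)
  have tr: "(\<lambda>r. transcript P ((x, y), r)) \<in> randomness P \<rightarrow>\<^sub>M T"
    by (rule measurable_transcript[OF x y])
  have eq: "{r\<in>space (randomness P). smp_output P x y r}
      = (\<lambda>r. transcript P ((x, y), r)) -` ?A \<inter> space (randomness P)"
    using measurable_space[OF tr] by (auto simp: smp_output_def transcript_def split_beta')
  show out: "{r\<in>space (randomness P). smp_output P x y r} \<in> sets (randomness P)"
    unfolding eq using tr A by (rule measurable_sets)
  note measurable_pA[OF x, measurable] measurable_pB[OF y, measurable] measurable_accept[measurable]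
  have ind: "(\<lambda>\<tau>. ennreal (pA x (viewA \<tau>) * pB y (viewB \<tau>)) * indicator ?A \<tau>) \<in> borel_measurable T"
    by measurable
  have "?L = (\<integral>\<^sup>+r. indicator ?A (transcript P ((x, y), r)) \<partial>randomness P)"
  proof -
    have "?L = (\<integral>\<^sup>+\<tau>. indicator ?A \<tau> \<partial>distr (randomness P) T (\<lambda>r. transcript P ((x, y), r)))"
      unfolding eq emeasure_distr[OF tr A, symmetric] by (rule nn_integral_indicator[symmetric]) simp
    also have "\<dots> = (\<integral>\<^sup>+r. indicator ?A (transcript P ((x, y), r)) \<partial>randomness P)"
      by (rule nn_integral_distr[OF tr]) measurable
    finally show ?thesis .
  qed
  also have "\<dots> = (\<integral>\<^sup>+\<tau>. ennreal (pA x (viewA \<tau>) * pB y (viewB \<tau>)) * indicator ?A \<tau> \<partial>T)"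
    by (intro nn_integral_transcript x y) measurable
  also have "\<dots> = (\<integral>\<^sup>+ma. \<integral>\<^sup>+rac. \<integral>\<^sup>+mb. \<integral>\<^sup>+rbc. \<integral>\<^sup>+rc.
      ennreal (pA x (ma, rac) * pB y (mb, rbc)) * indicator ?A (ma, mb, rc, rac, rbc)
      \<partial>RC P \<partial>RBC P \<partial>count_space (MB P) \<partial>RAC P \<partial>count_space (MA P))"
    using ind unfolding T_def
    by (subst nn_integral_shuffle[OF cA.sigma_finite_measure_axioms cB.sigma_finite_measure_axioms
        RC.sigma_finite_measure_axioms RAC.sigma_finite_measure_axioms RBC.sigma_finite_measure_axioms])
      (auto simp: viewA_def viewB_def)
  also have "\<dots> = (\<integral>\<^sup>+ma. \<integral>\<^sup>+rac. \<integral>\<^sup>+mb. \<integral>\<^sup>+rbc.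
      ennreal (pA x (ma, rac)) * ennreal (pB y (mb, rbc) * accept (ma, rac) (mb, rbc))
      \<partial>RBC P \<partial>count_space (MB P) \<partial>RAC P \<partial>count_space (MA P))"
  proof (intro nn_integral_cong)
    fix ma rac mb rbc
    assume s: "ma \<in> space (count_space (MA P))" "rac \<in> space (RAC P)"
      "mb \<in> space (count_space (MB P))" "rbc \<in> space (RBC P)"
    let ?B = "{rc\<in>space (RC P). PC P ma mb rc rac rbc}"
    have B: "?B \<in> sets (RC P)"
      using sets_RC_accept[of "(ma, rac)" "(mb, rbc)"] s by (simp add: space_pair_measure)
    have "(\<integral>\<^sup>+rc. ennreal (pA x (ma, rac) * pB y (mb, rbc)) * indicator ?A (ma, mb, rc, rac, rbc) \<partial>RC P)
      = (\<integral>\<^sup>+rc. ennreal (pA x (ma, rac) * pB y (mb, rbc)) * indicator ?B rc \<partial>RC P)"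
      using s by (intro nn_integral_cong) (auto simp: indicator_def T_def space_pair_measure)
    also have "\<dots> = ennreal (pA x (ma, rac) * pB y (mb, rbc)) * ennreal (accept (ma, rac) (mb, rbc))"
      using B by (simp add: nn_integral_cmult_indicator accept_def RC.emeasure_eq_measure)
    also have "\<dots> = ennreal (pA x (ma, rac)) * ennreal (pB y (mb, rbc) * accept (ma, rac) (mb, rbc))"
      by (simp add: ennreal_mult' pA_bounds pB_bounds accept_bounds mult.assoc)
    finally show "(\<integral>\<^sup>+rc. ennreal (pA x (ma, rac) * pB y (mb, rbc)) * indicator ?A (ma, mb, rc, rac, rbc) \<partial>RC P) = \<dots>" .
  qed
  also have "\<dots> = (\<integral>\<^sup>+ma. \<integral>\<^sup>+rac. ennreal (pA x (ma, rac)) *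
      (\<integral>\<^sup>+b. ennreal (pB y b * accept (ma, rac) b) \<partial>NB) \<partial>RAC P \<partial>count_space (MA P))"
  proof (intro nn_integral_cong)
    fix ma rac
    assume s: "ma \<in> space (count_space (MA P))" "rac \<in> space (RAC P)"
    then have a: "(ma, rac) \<in> space NA" by (simp add: space_pair_measure)
    have [measurable]: "accept (ma, rac) \<in> borel_measurable NB"
      using measurable_compose[OF measurable_Pair1'[OF a] measurable_accept] by simp
    show "(\<integral>\<^sup>+mb. \<integral>\<^sup>+rbc.
      ennreal (pA x (ma, rac)) * ennreal (pB y (mb, rbc) * accept (ma, rac) (mb, rbc))
      \<partial>RBC P \<partial>count_space (MB P)) = ennreal (pA x (ma, rac)) *
      (\<integral>\<^sup>+b. ennreal (pB y b * accept (ma, rac) b) \<partial>NB)"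
      by (subst nn_integral_cmult[symmetric], measurable, subst RBC.nn_integral_fst[symmetric]) auto
  qed
  also have "\<dots> = ?R"
    by (subst RAC.nn_integral_fst[symmetric]) auto
  finally show "?L = ?R" .
qed

section \<open>Leakage under uniform inputs\<close>

definition qA :: "'m \<times> 'r \<Rightarrow> real" where
  "qA a = (\<Sum>x\<in>S. pA x a) / card S"

definition qB :: "'m \<times> 'r \<Rightarrow> real" where
  "qB b = (\<Sum>y\<in>S. pB y b) / card S"

text \<open>The law of the transcript under uniform inputs, as \<open>distributed_transcript\<close>
  confirms. Keeping whole transcripts lets the densities of both players live on one probability
  space, although each depends on one view only.\<close>

definition M :: "('m \<times> 'm \<times> 'r \<times> 'r \<times> 'r) measure" where
  "M = density T (\<lambda>\<tau>. ennreal (qA (viewA \<tau>) * qB (viewB \<tau>)))"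

definition hA :: "'x \<Rightarrow> 'm \<times> 'm \<times> 'r \<times> 'r \<times> 'r \<Rightarrow> real" where
  "hA x \<tau> = pA x (viewA \<tau>) / qA (viewA \<tau>)"

definition hB :: "'x \<Rightarrow> 'm \<times> 'm \<times> 'r \<times> 'r \<times> 'r \<Rightarrow> real" where
  "hB y \<tau> = pB y (viewB \<tau>) / qB (viewB \<tau>)"

definition DA :: "'x \<Rightarrow> real" where
  "DA x = (\<integral>\<tau>. hA x \<tau> * ln (hA x \<tau>) \<partial>M)"

definition DB :: "'x \<Rightarrow> real" where
  "DB y = (\<integral>\<tau>. hB y \<tau> * ln (hB y \<tau>) \<partial>M)"

lemma card_S: "0 < real (card S)"
  using finite_S S_nonempty by (simp add: card_gt_0_iff)

lemma measurable_q[measurable]: "qA \<in> borel_measurable NA" "qB \<in> borel_measurable NB"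
  unfolding qA_def[abs_def] qB_def[abs_def] by measurable

lemma measurable_h[measurable]:
  "x \<in> S \<Longrightarrow> hA x \<in> borel_measurable T" "x \<in> S \<Longrightarrow> hB x \<in> borel_measurable T"
  unfolding hA_def[abs_def] hB_def[abs_def] by measurable

lemma q_bounds: "0 \<le> qA a" "qA a \<le> 1" "0 \<le> qB b" "qB b \<le> 1"
proof -
  have "(\<Sum>x\<in>S. pA x a) \<le> (\<Sum>x\<in>S. 1)" "(\<Sum>x\<in>S. pB x b) \<le> (\<Sum>x\<in>S. 1)"
    by (intro sum_mono pA_bounds pB_bounds)+
  then show "0 \<le> qA a" "qA a \<le> 1" "0 \<le> qB b" "qB b \<le> 1"
    using card_S by (auto simp: qA_def qB_def intro!: sum_nonneg pA_bounds pB_bounds divide_nonneg_nonneg)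
qed

text \<open>\<open>pA x\<close> is one of the \<open>card S\<close> nonnegative summands averaged in
  \<open>qA\<close>. This gives the uniform bound \<open>card S\<close> on the densities and shows
  that \<open>qA\<close> vanishes only where every \<open>pA x\<close> with \<open>x \<in> S\<close>
  does.\<close>

lemma p_le_q:
  assumes "x \<in> S"
  shows "pA x a \<le> card S * qA a" "pB x b \<le> card S * qB b"
proof -
  have "pA x a \<le> (\<Sum>x\<in>S. pA x a)" "pB x b \<le> (\<Sum>x\<in>S. pB x b)"
    using assms finite_S by (auto intro!: member_le_sum pA_bounds pB_bounds)
  then show "pA x a \<le> card S * qA a" "pB x b \<le> card S * qB b"
    using card_S by (auto simp: qA_def qB_def)
qed

text \<open>Where the mean density vanishes, division by zero makes \<open>hA\<close> and
  \<open>hB\<close> equal to 0. The identities survive because the numerators vanish there as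
  well.\<close>

lemma q_times_h:
  assumes "x \<in> S"
  shows "qA (viewA \<tau>) * hA x \<tau> = pA x (viewA \<tau>)" "qB (viewB \<tau>) * hB x \<tau> = pB x (viewB \<tau>)"
  using p_le_q(1)[OF assms, of "viewA \<tau>"] p_le_q(2)[OF assms, of "viewB \<tau>"]
    pA_bounds(1)[of x "viewA \<tau>"] pB_bounds(1)[of x "viewB \<tau>"]
  by (auto simp: hA_def hB_def)

lemma h_bounds:
  assumes "x \<in> S"
  shows "0 \<le> hA x \<tau>" "hA x \<tau> \<le> card S" "0 \<le> hB x \<tau>" "hB x \<tau> \<le> card S"
  using p_le_q(1)[OF assms, of "viewA \<tau>"] p_le_q(2)[OF assms, of "viewB \<tau>"]
    q_bounds(1)[of "viewA \<tau>"] q_bounds(3)[of "viewB \<tau>"] card_S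
    pA_bounds(1)[of x "viewA \<tau>"] pB_bounds(1)[of x "viewB \<tau>"]
  by (auto simp: hA_def hB_def divide_le_eq)

lemma integrable_p:
  assumes [measurable]: "x \<in> S"
  shows "integrable NA (pA x)" "integrable NB (pB x)"
  by (rule NA.integrable_bounded[where C=1] NB.integrable_bounded[where C=1];
      use pA_bounds pB_bounds in auto)+

lemma integral_p:
  assumes "x \<in> S"
  shows "(\<integral>a. pA x a \<partial>NA) = 1" "(\<integral>b. pB x b \<partial>NB) = 1"
  using nn_integral_pA[OF assms] nn_integral_pB[OF assms] assms
  by (auto simp: integral_eq_nn_integral pA_bounds pB_bounds)

lemma nn_integral_q: "(\<integral>\<^sup>+a. ennreal (qA a) \<partial>NA) = 1" "(\<integral>\<^sup>+b. ennreal (qB b) \<partial>NB) = 1"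
proof -
  have "(\<integral>a. qA a \<partial>NA) = 1" "(\<integral>b. qB b \<partial>NB) = 1"
    using card_S by (simp_all add: qA_def qB_def integrable_p integral_p)
  moreover have "integrable NA qA" "integrable NB qB"
    by (rule NA.integrable_bounded[where C=1] NB.integrable_bounded[where C=1];
      use q_bounds in auto)+
  ultimately show "(\<integral>\<^sup>+a. ennreal (qA a) \<partial>NA) = 1" "(\<integral>\<^sup>+b. ennreal (qB b) \<partial>NB) = 1"
    using q_bounds by (simp_all add: nn_integral_eq_integral)
qed

lemma prob_space_M: "prob_space M"
proof (rule prob_spaceI)
  have "emeasure M (space M) = (\<integral>\<^sup>+\<tau>. ennreal (qA (viewA \<tau>)) * ennreal (qB (viewB \<tau>)) \<partial>T)"
    by (simp add: M_def emeasure_density ennreal_mult q_bounds cong: nn_integral_cong)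
  also have "\<dots> = 1"
    by (subst nn_integral_views) (auto simp: nn_integral_q)
  finally show "emeasure M (space M) = 1" .
qed

sublocale M: prob_space M by (rule prob_space_M)

lemma sets_M[measurable_cong]: "sets M = sets T"
  by (simp add: M_def)

lemma space_M: "space M = space T"
  by (simp add: M_def)

section \<open>Integrals over the transcript law seen through one view\<close>

lemma integral_M:
  assumes [measurable]: "g \<in> borel_measurable T"
  shows "(\<integral>\<tau>. g \<tau> \<partial>M) = (\<integral>\<tau>. qA (viewA \<tau>) * qB (viewB \<tau>) * g \<tau> \<partial>T)"
  unfolding M_def using q_bounds by (subst integral_density) auto

text \<open>The views are independent under \<open>M\<close>, so Bob's mean density integrates to 1
  and disappears. Nonnegativity of \<open>u\<close> allows the calculation to run through
  nonnegative integrals, without integrability conditions.\<close>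

lemma integral_viewA:
  assumes x: "x \<in> S" and u[measurable]: "u \<in> borel_measurable NA" and u0: "\<And>a. 0 \<le> u a"
  shows "(\<integral>\<tau>. hA x \<tau> * u (viewA \<tau>) \<partial>M) = (\<integral>a. pA x a * u a \<partial>NA)"
proof -
  note x[measurable]
  have "(\<integral>\<tau>. hA x \<tau> * u (viewA \<tau>) \<partial>M)
    = (\<integral>\<tau>. pA x (viewA \<tau>) * u (viewA \<tau>) * qB (viewB \<tau>) \<partial>T)"
    by (subst integral_M) (auto simp: q_times_h[OF x, symmetric] ac_simps intro!: Bochner_Integration.integral_cong)
  also have "\<dots> = enn2real (\<integral>\<^sup>+\<tau>. ennreal (pA x (viewA \<tau>) * u (viewA \<tau>)) * ennreal (qB (viewB \<tau>)) \<partial>T)"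
    using u0 by (subst integral_eq_nn_integral)
      (auto simp: ennreal_mult' pA_bounds q_bounds intro!: AE_I2 mult_nonneg_nonneg)
  also have "\<dots> = enn2real (\<integral>\<^sup>+a. ennreal (pA x a * u a) \<partial>NA)"
    by (subst nn_integral_views) (auto simp: nn_integral_q)
  also have "\<dots> = (\<integral>a. pA x a * u a \<partial>NA)"
    using u0 by (subst integral_eq_nn_integral) (auto simp: pA_bounds)
  finally show ?thesis .
qed

lemma integral_viewB:
  assumes x: "x \<in> S" and u[measurable]: "u \<in> borel_measurable NB" and u0: "\<And>a. 0 \<le> u a"
  shows "(\<integral>\<tau>. hB x \<tau> * u (viewB \<tau>) \<partial>M) = (\<integral>b. pB x b * u b \<partial>NB)"
proof -
  note x[measurable]
  have "(\<integral>\<tau>. hB x \<tau> * u (viewB \<tau>) \<partial>M)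
    = (\<integral>\<tau>. qA (viewA \<tau>) * (pB x (viewB \<tau>) * u (viewB \<tau>)) \<partial>T)"
    by (subst integral_M) (auto simp: q_times_h[OF x, symmetric] ac_simps intro!: Bochner_Integration.integral_cong)
  also have "\<dots> = enn2real (\<integral>\<^sup>+\<tau>. ennreal (qA (viewA \<tau>)) * ennreal (pB x (viewB \<tau>) * u (viewB \<tau>)) \<partial>T)"
    using u0 by (subst integral_eq_nn_integral)
      (auto simp: ennreal_mult' pB_bounds q_bounds intro!: AE_I2 mult_nonneg_nonneg)
  also have "\<dots> = enn2real (\<integral>\<^sup>+a. ennreal (pB x a * u a) \<partial>NB)"
    by (subst nn_integral_views) (auto simp: nn_integral_q)
  also have "\<dots> = (\<integral>a. pB x a * u a \<partial>NB)"
    using u0 by (subst integral_eq_nn_integral) (auto simp: pB_bounds)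
  finally show ?thesis .
qed

lemma integral_h:
  assumes "x \<in> S"
  shows "(\<integral>\<tau>. hA x \<tau> \<partial>M) = 1" "(\<integral>\<tau>. hB x \<tau> \<partial>M) = 1"
  using integral_viewA[OF assms, of "\<lambda>_. 1"] integral_viewB[OF assms, of "\<lambda>_. 1"] assms
  by (simp_all add: integral_p)

lemma D_nonneg:
  assumes [measurable]: "x \<in> S"
  shows "0 \<le> DA x" "0 \<le> DB x"
  unfolding DA_def DB_def using assms
  by (auto intro!: M.relative_entropy_nonneg[where K="card S"] simp: h_bounds integral_h)

lemma prob_space_randomness: "prob_space (randomness P)"
  unfolding randomness_def by (intro prob_space_pair prob_spaces)

text \<open>For fixed inputs the views are independent, so Alice's may be read from one transcript
  and Bob's from another, independent one. This is the shape of acceptance probability that the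
  decoding bound expects.\<close>

lemma integral_accept:
  assumes x: "x \<in> S" and y: "y \<in> S"
  shows "(\<integral>\<tau>. hA x \<tau> * (\<integral>\<tau>'. hB y \<tau>' * accept (viewA \<tau>) (viewB \<tau>') \<partial>M) \<partial>M)
    = measure (randomness P) {r\<in>space (randomness P). smp_output P x y r}"
proof -
  interpret R: prob_space "randomness P" by (rule prob_space_randomness)
  note measurable_accept[measurable] x[measurable] y[measurable]
  have acc[measurable]: "accept a \<in> borel_measurable NB" if "a \<in> space NA" for a
    using measurable_compose[OF measurable_Pair1'[OF that] measurable_accept] by simp
  define v where "v = (\<lambda>a. \<integral>b. pB y b * accept a b \<partial>NB)"
  have vm[measurable]: "v \<in> borel_measurable NA"
    unfolding v_def by measurable
  have v0: "0 \<le> v a" for a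
    unfolding v_def by (auto intro!: integral_nonneg_AE simp: pB_bounds accept_bounds)
  have ib: "integrable NB (\<lambda>b. pB y b * accept a b)" if "a \<in> space NA" for a
    using that by (intro NB.integrable_bounded[where C=1])
      (auto simp: pB_bounds accept_bounds abs_mult intro!: mult_le_one)
  have v1: "v a \<le> 1" if "a \<in> space NA" for a
  proof -
    have "v a \<le> (\<integral>b. pB y b \<partial>NB)"
      unfolding v_def using ib[OF that] integrable_p[OF y]
      by (intro integral_mono) (auto simp: pB_bounds accept_bounds intro!: mult_left_le)
    then show ?thesis by (simp add: integral_p[OF y])
  qed
  have "(\<integral>\<tau>. hA x \<tau> * (\<integral>\<tau>'. hB y \<tau>' * accept (viewA \<tau>) (viewB \<tau>') \<partial>M) \<partial>M)
      = (\<integral>\<tau>. hA x \<tau> * v (viewA \<tau>) \<partial>M)"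
  proof (intro Bochner_Integration.integral_cong refl arg_cong2[where f="(*)"])
    fix \<tau> assume "\<tau> \<in> space M"
    then have "viewA \<tau> \<in> space NA" using measurable_space[OF measurable_viewA] by (simp add: space_M)
    then show "(\<integral>\<tau>'. hB y \<tau>' * accept (viewA \<tau>) (viewB \<tau>') \<partial>M) = v (viewA \<tau>)"
      unfolding v_def by (intro integral_viewB y acc accept_bounds)
  qed
  also have "\<dots> = (\<integral>a. pA x a * v a \<partial>NA)"
    by (intro integral_viewA x v0) measurable
  finally have L: "(\<integral>\<tau>. hA x \<tau> * (\<integral>\<tau>'. hB y \<tau>' * accept (viewA \<tau>) (viewB \<tau>') \<partial>M) \<partial>M)
      = (\<integral>a. pA x a * v a \<partial>NA)" .
  have "emeasure (randomness P) {r\<in>space (randomness P). smp_output P x y r}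
    = (\<integral>\<^sup>+a. ennreal (pA x a) * (\<integral>\<^sup>+b. ennreal (pB y b * accept a b) \<partial>NB) \<partial>NA)"
    by (rule emeasure_accept[OF x y])
  also have "\<dots> = (\<integral>\<^sup>+a. ennreal (pA x a * v a) \<partial>NA)"
  proof (rule nn_integral_cong)
    fix a assume "a \<in> space NA"
    then have "(\<integral>\<^sup>+b. ennreal (pB y b * accept a b) \<partial>NB) = ennreal (v a)"
      unfolding v_def by (intro nn_integral_eq_integral ib AE_I2 mult_nonneg_nonneg pB_bounds accept_bounds)
    then show "ennreal (pA x a) * (\<integral>\<^sup>+b. ennreal (pB y b * accept a b) \<partial>NB) = ennreal (pA x a * v a)"
      by (simp only: ennreal_mult' pA_bounds)
  qed
  also have "\<dots> = ennreal (\<integral>a. pA x a * v a \<partial>NA)"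
  proof (rule nn_integral_eq_integral)
    show "integrable NA (\<lambda>a. pA x a * v a)"
      by (intro NA.integrable_bounded[where C=1])
        (auto simp: pA_bounds v0 v1 abs_mult intro!: mult_le_one)
  qed (auto simp: pA_bounds v0)
  finally show ?thesis unfolding L
    by (simp add: R.emeasure_eq_measure integral_nonneg_AE pA_bounds v0)
qed

lemma accept_correct:
  assumes x: "x \<in> S"
  shows "1 - \<epsilon> \<le> (\<integral>\<tau>. hA x \<tau> * (\<integral>\<tau>'. hB x \<tau>' * accept (viewA \<tau>) (viewB \<tau>') \<partial>M) \<partial>M)"
proof -
  interpret R: prob_space "randomness P" by (rule prob_space_randomness)
  let ?out = "{r\<in>space (randomness P). smp_output P x x r}"
  have "R.prob (space (randomness P) - ?out) = 1 - R.prob ?out"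
    by (intro R.prob_compl emeasure_accept x)
  moreover have "space (randomness P) - ?out = {r\<in>space (randomness P). smp_output P x x r \<noteq> (x = x)}"
    by auto
  ultimately have "1 - R.prob ?out \<le> \<epsilon>"
    using correct[unfolded computes_with_error_def, rule_format, OF x x] by simp
  then show ?thesis unfolding integral_accept[OF x x] by simp
qed

lemma accept_incorrect:
  assumes "x \<in> S" "y \<in> S" "x \<noteq> y"
  shows "(\<integral>\<tau>. hA x \<tau> * (\<integral>\<tau>'. hB y \<tau>' * accept (viewA \<tau>) (viewB \<tau>') \<partial>M) \<partial>M) \<le> \<epsilon>"
proof -
  have "measure (randomness P) {r\<in>space (randomness P). smp_output P x y r \<noteq> (x = y)} \<le> \<epsilon>"
    using correct[unfolded computes_with_error_def, rule_format, OF assms(1,2)] .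
  then show ?thesis using assms by (simp add: integral_accept)
qed

section \<open>Relative entropies as averages over pairs of inputs\<close>

lemma abs_p_ln_h:
  assumes x: "x \<in> S"
  shows "\<bar>pA x (viewA \<tau>) * ln (hA x \<tau>)\<bar> \<le> 1 + real (card S) * real (card S)"
    "\<bar>pB x (viewB \<tau>) * ln (hB x \<tau>)\<bar> \<le> 1 + real (card S) * real (card S)"
proof -
  have "\<bar>qA (viewA \<tau>) * (hA x \<tau> * ln (hA x \<tau>))\<bar> \<le> 1 * (1 + real (card S) * real (card S))"
    by (intro abs_mult_le q_bounds abs_times_ln_le h_bounds[OF x])
  then show "\<bar>pA x (viewA \<tau>) * ln (hA x \<tau>)\<bar> \<le> 1 + real (card S) * real (card S)"
    by (simp add: q_times_h[OF x, symmetric] mult.assoc)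
  have "\<bar>qB (viewB \<tau>) * (hB x \<tau> * ln (hB x \<tau>))\<bar> \<le> 1 * (1 + real (card S) * real (card S))"
    by (intro abs_mult_le q_bounds abs_times_ln_le h_bounds[OF x])
  then show "\<bar>pB x (viewB \<tau>) * ln (hB x \<tau>)\<bar> \<le> 1 + real (card S) * real (card S)"
    by (simp add: q_times_h[OF x, symmetric] mult.assoc)
qed

lemma abs_p_p_ln_h:
  assumes x: "x \<in> S" and y: "y \<in> S"
  shows "\<bar>pB y (viewB \<tau>) * (pA x (viewA \<tau>) * ln (hA x \<tau>))\<bar> \<le> 1 * (1 + real (card S) * real (card S))"
    and "\<bar>pA x (viewA \<tau>) * (pB y (viewB \<tau>) * ln (hB y \<tau>))\<bar> \<le> 1 * (1 + real (card S) * real (card S))"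
  by (intro abs_mult_le abs_p_ln_h[OF x] abs_p_ln_h[OF y] pA_bounds pB_bounds)+

lemma integrable_p_ln_h:
  assumes [measurable]: "x \<in> S" "y \<in> S"
  shows "integrable T (\<lambda>\<tau>. pB y (viewB \<tau>) * (pA x (viewA \<tau>) * ln (hA x \<tau>)))"
    and "integrable T (\<lambda>\<tau>. pA x (viewA \<tau>) * (pB y (viewB \<tau>) * ln (hB y \<tau>)))"
  by (rule T.integrable_bounded[OF _ abs_p_p_ln_h(1)] T.integrable_bounded[OF _ abs_p_p_ln_h(2)];
      use assms in measurable)+

text \<open>Expanding the other player's mean density \<open>qB\<close> or \<open>qA\<close> as an
  average over inputs writes each divergence through the same integrals, indexed by pairs of inputs,
  that appear in the mutual information.\<close>

lemma D_eq:
  assumes x: "x \<in> S"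
  shows "DA x = (\<Sum>y\<in>S. \<integral>\<tau>. pB y (viewB \<tau>) * (pA x (viewA \<tau>) * ln (hA x \<tau>)) \<partial>T) / card S"
    and "DB x = (\<Sum>y\<in>S. \<integral>\<tau>. pA y (viewA \<tau>) * (pB x (viewB \<tau>) * ln (hB x \<tau>)) \<partial>T) / card S"
proof -
  note x[measurable]
  have eqA: "qA (viewA \<tau>) * qB (viewB \<tau>) * (hA x \<tau> * ln (hA x \<tau>))
    = (\<Sum>y\<in>S. pB y (viewB \<tau>) * (pA x (viewA \<tau>) * ln (hA x \<tau>))) / card S" for \<tau>
  proof -
    have "qA (viewA \<tau>) * qB (viewB \<tau>) * (hA x \<tau> * ln (hA x \<tau>))
      = qB (viewB \<tau>) * ((qA (viewA \<tau>) * hA x \<tau>) * ln (hA x \<tau>))"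
      by (simp only: ac_simps)
    then show ?thesis unfolding q_times_h[OF x] by (simp add: qB_def sum_distrib_right)
  qed
  have eqB: "qA (viewA \<tau>) * qB (viewB \<tau>) * (hB x \<tau> * ln (hB x \<tau>))
    = (\<Sum>y\<in>S. pA y (viewA \<tau>) * (pB x (viewB \<tau>) * ln (hB x \<tau>))) / card S" for \<tau>
  proof -
    have "qA (viewA \<tau>) * qB (viewB \<tau>) * (hB x \<tau> * ln (hB x \<tau>))
      = qA (viewA \<tau>) * ((qB (viewB \<tau>) * hB x \<tau>) * ln (hB x \<tau>))"
      by (simp only: ac_simps)
    then show ?thesis unfolding q_times_h[OF x] by (simp add: qA_def sum_distrib_right)
  qed
  have "DA x = (\<integral>\<tau>. (\<Sum>y\<in>S. pB y (viewB \<tau>) * (pA x (viewA \<tau>) * ln (hA x \<tau>))) / card S \<partial>T)"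
    unfolding DA_def by (subst integral_M) (simp_all only: eqA, measurable)
  then show "DA x = (\<Sum>y\<in>S. \<integral>\<tau>. pB y (viewB \<tau>) * (pA x (viewA \<tau>) * ln (hA x \<tau>)) \<partial>T) / card S"
    using x by (simp add: integrable_p_ln_h)
  have "DB x = (\<integral>\<tau>. (\<Sum>y\<in>S. pA y (viewA \<tau>) * (pB x (viewB \<tau>) * ln (hB x \<tau>))) / card S \<partial>T)"
    unfolding DB_def by (subst integral_M) (simp_all only: eqB, measurable)
  then show "DB x = (\<Sum>y\<in>S. \<integral>\<tau>. pA y (viewA \<tau>) * (pB x (viewB \<tau>) * ln (hB x \<tau>)) \<partial>T) / card S"
    using x by (simp add: integrable_p_ln_h)
qed

section \<open>Joint law of inputs and transcript, and its mutual information\<close>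

definition \<mu> :: "('x \<times> 'x) measure" where
  "\<mu> = uniform_count_measure (S \<times> S)"

definition joint :: "('x \<times> 'x) \<times> 'm \<times> 'm \<times> 'r \<times> 'r \<times> 'r \<Rightarrow> real" where
  "joint p = pA (fst (fst p)) (viewA (snd p)) * pB (snd (fst p)) (viewB (snd p)) / (card S * card S)"

lemma finite_SS: "finite (S \<times> S)" "S \<times> S \<noteq> {}"
  using finite_S S_nonempty by auto

lemma input_distribution: "\<mu> \<in> input_distributions S S"
  using finite_SS by (auto simp: \<mu>_def input_distributions_def prob_space_uniform_count_measure sets_uniform_count_measure)

lemma nn_integral_inputs: "(\<integral>\<^sup>+p. g p \<partial>\<mu>) = (\<Sum>p\<in>S \<times> S. ennreal (1 / (card S * card S)) * g p)"
  using finite_SS(1) unfolding \<mu>_def uniform_count_measure_def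
  by (subst nn_integral_point_measure_finite) (auto simp: card_cartesian_product intro!: sum.cong)

lemma sets_inputs[measurable_cong]: "sets \<mu> = sets (count_space (S \<times> S))"
  by (simp add: \<mu>_def sets_uniform_count_measure)

lemma measurable_joint[measurable]: "joint \<in> borel_measurable (count_space (S \<times> S) \<Otimes>\<^sub>M T)"
proof (rule measurable_pair_measure_countable1)
  fix p assume "p \<in> S \<times> S"
  then have [measurable]: "fst p \<in> S" "snd p \<in> S" by auto
  show "(\<lambda>y. joint (p, y)) \<in> borel_measurable T"
    unfolding joint_def by simp measurable
qed (use finite_SS in \<open>auto intro: countable_finite\<close>)

lemma measurable_joint_slice: "p \<in> S \<times> S \<Longrightarrow> (\<lambda>\<tau>. joint (p, \<tau>)) \<in> borel_measurable T"
  using measurable_compose[OF measurable_Pair1'[of p "count_space (S \<times> S)"] measurable_joint] by simp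

lemma joint_nonneg: "0 \<le> joint p"
  by (simp add: joint_def pA_bounds pB_bounds)

lemma measurable_transcript_joint: "transcript P \<in> \<mu> \<Otimes>\<^sub>M randomness P \<rightarrow>\<^sub>M T"
proof -
  have "transcript P \<in> count_space (S \<times> S) \<Otimes>\<^sub>M randomness P \<rightarrow>\<^sub>M T"
    by (rule measurable_pair_measure_countable1)
      (use finite_SS measurable_transcript in \<open>auto intro: countable_finite\<close>)
  then show ?thesis
    by (simp only: measurable_cong_sets[OF sets_pair_measure_cong[OF sets_inputs refl] refl])
qed

lemma prob_space_inputs: "prob_space \<mu>"
  using input_distribution by (simp add: input_distributions_def)

text \<open>Stated for arbitrary test functions, so that indicators give both the joint law and the
  marginal law of the transcript.\<close>

lemma nn_integral_execution:
  fixes G :: "_ \<Rightarrow> ennreal"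
  assumes G[measurable]: "G \<in> borel_measurable (count_space (S \<times> S) \<Otimes>\<^sub>M T)"
  shows "(\<integral>\<^sup>+w. G (fst w, transcript P w) \<partial>(\<mu> \<Otimes>\<^sub>M randomness P))
    = (\<Sum>p\<in>S \<times> S. \<integral>\<^sup>+\<tau>. ennreal (joint (p, \<tau>)) * G (p, \<tau>) \<partial>T)"
proof -
  interpret R: prob_space "randomness P" by (rule prob_space_randomness)
  note measurable_transcript_joint[measurable]
  have [measurable]: "G \<in> borel_measurable (\<mu> \<Otimes>\<^sub>M T)"
    using G by (subst measurable_cong_sets[OF sets_pair_measure_cong[OF sets_inputs refl] refl])
  have [measurable]: "(\<lambda>w. G (fst w, transcript P w)) \<in> borel_measurable (\<mu> \<Otimes>\<^sub>M randomness P)"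
    by measurable
  have "(\<integral>\<^sup>+w. G (fst w, transcript P w) \<partial>(\<mu> \<Otimes>\<^sub>M randomness P))
    = (\<integral>\<^sup>+p. \<integral>\<^sup>+r. G (p, transcript P (p, r)) \<partial>randomness P \<partial>\<mu>)"
    by (subst R.nn_integral_fst[symmetric]) auto
  also have "\<dots> = (\<Sum>p\<in>S \<times> S. ennreal (1 / (card S * card S)) * (\<integral>\<^sup>+r. G (p, transcript P (p, r)) \<partial>randomness P))"
    by (rule nn_integral_inputs)
  also have "\<dots> = (\<Sum>p\<in>S \<times> S. \<integral>\<^sup>+\<tau>. ennreal (joint (p, \<tau>)) * G (p, \<tau>) \<partial>T)"
  proof (rule sum.cong[OF refl])
    fix p assume p: "p \<in> S \<times> S"
    then obtain x y where xy: "p = (x, y)" and [measurable]: "x \<in> S" "y \<in> S" by auto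
    have Gp[measurable]: "(\<lambda>\<tau>. G (p, \<tau>)) \<in> borel_measurable T"
      using measurable_compose[OF measurable_Pair1'[of p "count_space (S \<times> S)"] G] p by simp
    have "ennreal (1 / (card S * card S)) * (\<integral>\<^sup>+r. G (p, transcript P (p, r)) \<partial>randomness P)
      = ennreal (1 / (card S * card S)) *
        (\<integral>\<^sup>+\<tau>. ennreal (pA x (viewA \<tau>) * pB y (viewB \<tau>)) * G (p, \<tau>) \<partial>T)"
      using nn_integral_transcript[of x y "\<lambda>\<tau>. G (p, \<tau>)"] Gp \<open>x \<in> S\<close> \<open>y \<in> S\<close> unfolding xy by simp
    also have "\<dots> = (\<integral>\<^sup>+\<tau>. ennreal (1 / (card S * card S)) * (ennreal (pA x (viewA \<tau>) * pB y (viewB \<tau>)) * G (p, \<tau>)) \<partial>T)"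
      by (rule nn_integral_cmult[symmetric]) measurable
    also have "\<dots> = (\<integral>\<^sup>+\<tau>. ennreal (joint (p, \<tau>)) * G (p, \<tau>) \<partial>T)"
    proof (rule nn_integral_cong)
      fix \<tau>
      have "joint (p, \<tau>) = 1 / (card S * card S) * (pA x (viewA \<tau>) * pB y (viewB \<tau>))"
        by (simp add: joint_def xy)
      then have "ennreal (joint (p, \<tau>)) = ennreal (1 / (card S * card S)) * ennreal (pA x (viewA \<tau>) * pB y (viewB \<tau>))"
        by (simp only: ennreal_mult' of_nat_0_le_iff zero_le_divide_1_iff)
      then show "ennreal (1 / (card S * card S)) * (ennreal (pA x (viewA \<tau>) * pB y (viewB \<tau>)) * G (p, \<tau>))
        = ennreal (joint (p, \<tau>)) * G (p, \<tau>)" by (simp only: mult.assoc)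
    qed
    finally show "ennreal (1 / (card S * card S)) * (\<integral>\<^sup>+r. G (p, transcript P (p, r)) \<partial>randomness P)
      = (\<integral>\<^sup>+\<tau>. ennreal (joint (p, \<tau>)) * G (p, \<tau>) \<partial>T)" .
  qed
  finally show ?thesis .
qed

lemma distributed_inputs:
  "distributed (\<mu> \<Otimes>\<^sub>M randomness P) (count_space (S \<times> S)) fst (\<lambda>_. ennreal (1 / (card S * card S)))"
proof -
  interpret R: prob_space "randomness P" by (rule prob_space_randomness)
  interpret I: prob_space \<mu> by (rule prob_space_inputs)
  have "distr (\<mu> \<Otimes>\<^sub>M randomness P) (count_space (S \<times> S)) fst = distr (\<mu> \<Otimes>\<^sub>M randomness P) \<mu> fst"
    by (intro distr_cong) (auto simp: sets_inputs)
  also have "\<dots> = \<mu>" by (rule R.distr_pair_fst)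
  also have "\<mu> = density (count_space (S \<times> S)) (\<lambda>_. ennreal (1 / (card S * card S)))"
    by (simp add: \<mu>_def uniform_count_measure_def point_measure_def card_cartesian_product)
  finally show ?thesis unfolding distributed_def by simp
qed

lemma distributed_joint:
  "distributed (\<mu> \<Otimes>\<^sub>M randomness P) (count_space (S \<times> S) \<Otimes>\<^sub>M T) (\<lambda>w. (fst w, transcript P w))
    (\<lambda>p. ennreal (joint p))"
proof -
  note measurable_transcript_joint[measurable]
  have m[measurable]: "(\<lambda>w. (fst w, transcript P w)) \<in> \<mu> \<Otimes>\<^sub>M randomness P \<rightarrow>\<^sub>M count_space (S \<times> S) \<Otimes>\<^sub>M T"
    by measurable
  have "distr (\<mu> \<Otimes>\<^sub>M randomness P) (count_space (S \<times> S) \<Otimes>\<^sub>M T) (\<lambda>w. (fst w, transcript P w))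
    = density (count_space (S \<times> S) \<Otimes>\<^sub>M T) (\<lambda>p. ennreal (joint p))" (is "?L = ?R")
  proof (rule measure_eqI)
    fix A assume "A \<in> sets ?L"
    then have A[measurable]: "A \<in> sets (count_space (S \<times> S) \<Otimes>\<^sub>M T)" by simp
    have "emeasure ?L A = (\<integral>\<^sup>+p. indicator A p \<partial>?L)" by (rule nn_integral_indicator[symmetric]) simp
    also have "\<dots> = (\<integral>\<^sup>+w. indicator A (fst w, transcript P w) \<partial>(\<mu> \<Otimes>\<^sub>M randomness P))"
      by (rule nn_integral_distr[OF m]) measurable
    also have "\<dots> = (\<Sum>p\<in>S \<times> S. \<integral>\<^sup>+\<tau>. ennreal (joint (p, \<tau>)) * indicator A (p, \<tau>) \<partial>T)"
      by (rule nn_integral_execution) measurable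
    also have "\<dots> = (\<integral>\<^sup>+p. \<integral>\<^sup>+\<tau>. ennreal (joint (p, \<tau>)) * indicator A (p, \<tau>) \<partial>T \<partial>count_space (S \<times> S))"
      using finite_SS by (simp add: nn_integral_count_space_finite)
    also have "\<dots> = (\<integral>\<^sup>+q. ennreal (joint q) * indicator A q \<partial>(count_space (S \<times> S) \<Otimes>\<^sub>M T))"
      by (subst T.nn_integral_fst[symmetric]) auto
    also have "\<dots> = emeasure ?R A" by (rule emeasure_density[symmetric]) measurable
    finally show "emeasure ?L A = emeasure ?R A" .
  qed simp
  then show ?thesis unfolding distributed_def by simp
qed

lemma sum_joint: "(\<Sum>p\<in>S \<times> S. joint (p, \<tau>)) = qA (viewA \<tau>) * qB (viewB \<tau>)"
  by (simp add: joint_def qA_def qB_def sum_product sum_divide_distrib sum.cartesian_product split_beta')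

lemma distributed_transcript:
  "distributed (\<mu> \<Otimes>\<^sub>M randomness P) T (transcript P) (\<lambda>\<tau>. ennreal (qA (viewA \<tau>) * qB (viewB \<tau>)))"
proof -
  note m = measurable_transcript_joint[measurable]
  have "distr (\<mu> \<Otimes>\<^sub>M randomness P) T (transcript P) = M" (is "?L = _")
  proof (rule measure_eqI)
    fix A assume "A \<in> sets ?L"
    then have A[measurable]: "A \<in> sets T" by simp
    note measurable_joint_slice[measurable]
    have "emeasure ?L A = (\<integral>\<^sup>+p. indicator A p \<partial>?L)" by (rule nn_integral_indicator[symmetric]) simp
    also have "\<dots> = (\<integral>\<^sup>+w. indicator A (transcript P w) \<partial>(\<mu> \<Otimes>\<^sub>M randomness P))"
      by (rule nn_integral_distr[OF m]) measurable
    also have "\<dots> = (\<Sum>p\<in>S \<times> S. \<integral>\<^sup>+\<tau>. ennreal (joint (p, \<tau>)) * indicator A \<tau> \<partial>T)"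
      using nn_integral_execution[of "\<lambda>q. indicator A (snd q)"] by simp
    also have "\<dots> = (\<integral>\<^sup>+\<tau>. (\<Sum>p\<in>S \<times> S. ennreal (joint (p, \<tau>)) * indicator A \<tau>) \<partial>T)"
      by (rule nn_integral_sum[symmetric]) measurable
    also have "\<dots> = (\<integral>\<^sup>+\<tau>. ennreal (qA (viewA \<tau>) * qB (viewB \<tau>)) * indicator A \<tau> \<partial>T)"
      by (simp only: sum_distrib_right[symmetric] sum_ennreal joint_nonneg sum_joint)
    also have "\<dots> = emeasure M A" unfolding M_def by (rule emeasure_density[symmetric]) measurable
    finally show "emeasure ?L A = emeasure M A" .
  qed (simp add: sets_M)
  then show ?thesis unfolding distributed_def M_def by simp
qed

text \<open>Independent inputs and conditionally independent views make the ratio of the joint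
  density to the product of its marginals equal to \<open>hA x \<tau> * hB y \<tau>\<close>. Its
  logarithm splits into one part for each player. If a density vanishes, both sides are 0, whatever
  the logarithm is.\<close>

lemma joint_log:
  assumes "x \<in> S" "y \<in> S"
  shows "joint ((x, y), \<tau>) *
      log 2 (joint ((x, y), \<tau>) / (1 / (card S * card S) * (qA (viewA \<tau>) * qB (viewB \<tau>))))
    = (pB y (viewB \<tau>) * (pA x (viewA \<tau>) * ln (hA x \<tau>)) + pA x (viewA \<tau>) * (pB y (viewB \<tau>) * ln (hB y \<tau>)))
      / (card S * card S * ln 2)"
proof (cases "pA x (viewA \<tau>) = 0 \<or> pB y (viewB \<tau>) = 0")
  case True
  then show ?thesis by (auto simp: joint_def)
next
  case False
  then have p: "0 < pA x (viewA \<tau>)" "0 < pB y (viewB \<tau>)"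
    using pA_bounds(1)[of x "viewA \<tau>"] pB_bounds(1)[of y "viewB \<tau>"] by auto
  have q: "0 < qA (viewA \<tau>)" "0 < qB (viewB \<tau>)"
    using zero_less_mult_pos[OF less_le_trans[OF p(1) p_le_q(1)[OF assms(1)]] card_S]
      zero_less_mult_pos[OF less_le_trans[OF p(2) p_le_q(2)[OF assms(2)]] card_S] by auto
  have h: "0 < hA x \<tau>" "0 < hB y \<tau>"
    unfolding hA_def hB_def using p q by auto
  have "joint ((x, y), \<tau>) / (1 / (card S * card S) * (qA (viewA \<tau>) * qB (viewB \<tau>))) = hA x \<tau> * hB y \<tau>"
    using card_S by (simp add: joint_def hA_def hB_def)
  moreover have "log 2 (hA x \<tau> * hB y \<tau>) = (ln (hA x \<tau>) + ln (hB y \<tau>)) / ln 2"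
    using h by (simp add: log_def ln_mult)
  ultimately show ?thesis by (simp add: joint_def distrib_left mult.commute mult.left_commute)
qed

text \<open>Integrating \<open>joint_log\<close> and summing over pairs of inputs yields an exact
  identity. The divergences are measured in nats, so \<open>ln 2\<close> converts to bits.\<close>

lemma information_leakage_uniform:
  "information_leakage_dist S S P \<mu> = (\<Sum>x\<in>S. DA x + DB x) / (card S * ln 2)"
proof -
  interpret R: prob_space "randomness P" by (rule prob_space_randomness)
  interpret I: prob_space \<mu> by (rule prob_space_inputs)
  interpret IR: pair_prob_space \<mu> "randomness P" ..
  interpret info: information_space "\<mu> \<Otimes>\<^sub>M randomness P" 2
    by unfold_locales simp
  interpret cS: finite_measure "count_space (S \<times> S)"
    by (intro finite_measure_count_space finite_SS)
  interpret ST: pair_sigma_finite "count_space (S \<times> S)" T ..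
  have fin: "finite_measure (count_space (S \<times> S) \<Otimes>\<^sub>M T)"
    by (intro finite_measure_pair_measure cS.finite_measure_axioms T.finite_measure_axioms)
  let ?q = "\<lambda>\<tau>. qA (viewA \<tau>) * qB (viewB \<tau>)"
  let ?c = "real (card S * card S)"
  let ?f = "\<lambda>w. joint w * log 2 (joint w / (1 / ?c * ?q (snd w)))"
  let ?g = "\<lambda>x y \<tau>. pB y (viewB \<tau>) * (pA x (viewA \<tau>) * ln (hA x \<tau>)) + pA x (viewA \<tau>) * (pB y (viewB \<tau>) * ln (hB y \<tau>))"
  have f: "?f ((x, y), \<tau>) = ?g x y \<tau> / (?c * ln 2)" if "x \<in> S" "y \<in> S" for x y \<tau>
    using joint_log[OF that] by simp
  have "information_leakage_dist S S P \<mu>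
      = prob_space.mutual_information (\<mu> \<Otimes>\<^sub>M randomness P) 2 (count_space (S \<times> S)) T fst (transcript P)"
    by (simp add: information_leakage_dist_def T_def)
  also have "\<dots> = (\<integral>w. ?f w \<partial>(count_space (S \<times> S) \<Otimes>\<^sub>M T))"
    by (rule info.mutual_information_distr[OF cS.sigma_finite_measure_axioms T.sigma_finite_measure_axioms
        distributed_inputs _ distributed_transcript _ distributed_joint])
      (simp_all add: q_bounds joint_nonneg)
  also have "\<dots> = (\<integral>p. \<integral>\<tau>. ?f (p, \<tau>) \<partial>T \<partial>count_space (S \<times> S))"
  proof (rule ST.integral_fst'[symmetric])
    show "integrable (count_space (S \<times> S) \<Otimes>\<^sub>M T) ?f"
    proof (rule finite_measure.integrable_bounded[OF fin])
      fix w assume "w \<in> space (count_space (S \<times> S) \<Otimes>\<^sub>M T)"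
      then obtain x y \<tau> where w: "w = ((x, y), \<tau>)" "x \<in> S" "y \<in> S"
        by (auto simp: space_pair_measure)
      let ?C = "2 * (1 + real (card S) * real (card S))"
      have "\<bar>?g x y \<tau>\<bar> \<le> ?C"
        using abs_p_p_ln_h[OF w(2,3), of \<tau>] by linarith
      then have "\<bar>?g x y \<tau>\<bar> / (?c * ln 2) \<le> ?C / (?c * ln 2)"
        by (intro divide_right_mono) auto
      then show "\<bar>?f w\<bar> \<le> ?C / (?c * ln 2)"
        unfolding w(1) f[OF w(2,3)] abs_divide by (simp add: abs_mult)
    qed measurable
  qed
  also have "\<dots> = (\<Sum>p\<in>S \<times> S. \<integral>\<tau>. ?f (p, \<tau>) \<partial>T)"
    using finite_SS by (simp only: lebesgue_integral_count_space_finite)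
  also have "\<dots> = (\<Sum>x\<in>S. \<Sum>y\<in>S. \<integral>\<tau>. ?f ((x, y), \<tau>) \<partial>T)"
    by (simp only: sum.cartesian_product split_beta' prod.collapse)
  also have "\<dots> = (\<Sum>x\<in>S. \<Sum>y\<in>S. (\<integral>\<tau>. pB y (viewB \<tau>) * (pA x (viewA \<tau>) * ln (hA x \<tau>)) \<partial>T) / (?c * ln 2)
      + (\<integral>\<tau>. pA x (viewA \<tau>) * (pB y (viewB \<tau>) * ln (hB y \<tau>)) \<partial>T) / (?c * ln 2))"
  proof (intro sum.cong refl)
    fix x y assume xy: "x \<in> S" "y \<in> S"
    have "(\<integral>\<tau>. ?f ((x, y), \<tau>) \<partial>T) = (\<integral>\<tau>. ?g x y \<tau> / (?c * ln 2) \<partial>T)"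
      by (simp only: f[OF xy])
    also have "\<dots> = (\<integral>\<tau>. ?g x y \<tau> \<partial>T) / (?c * ln 2)" by (rule integral_divide_zero)
    also have "(\<integral>\<tau>. ?g x y \<tau> \<partial>T) = (\<integral>\<tau>. pB y (viewB \<tau>) * (pA x (viewA \<tau>) * ln (hA x \<tau>)) \<partial>T)
      + (\<integral>\<tau>. pA x (viewA \<tau>) * (pB y (viewB \<tau>) * ln (hB y \<tau>)) \<partial>T)"
      by (intro Bochner_Integration.integral_add integrable_p_ln_h xy)
    finally show "(\<integral>\<tau>. ?f ((x, y), \<tau>) \<partial>T) = (\<integral>\<tau>. pB y (viewB \<tau>) * (pA x (viewA \<tau>) * ln (hA x \<tau>)) \<partial>T) / (?c * ln 2)
      + (\<integral>\<tau>. pA x (viewA \<tau>) * (pB y (viewB \<tau>) * ln (hB y \<tau>)) \<partial>T) / (?c * ln 2)"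
      by (simp only: add_divide_distrib)
  qed
  \<comment> \<open>For Alice's part the inner sum over \<open>y\<close> is the one in
    \<open>D_eq\<close>. For Bob's part the two sums are exchanged first.\<close>
  also have "\<dots> = (\<Sum>x\<in>S. DA x) / (card S * ln 2) + (\<Sum>y\<in>S. DB y) / (card S * ln 2)"
  proof -
    have "(\<Sum>x\<in>S. \<Sum>y\<in>S. (\<integral>\<tau>. pB y (viewB \<tau>) * (pA x (viewA \<tau>) * ln (hA x \<tau>)) \<partial>T) / (?c * ln 2))
      = (\<Sum>x\<in>S. DA x) / (card S * ln 2)"
      by (simp add: D_eq sum_divide_distrib mult.assoc cong: sum.cong)
    moreover have "(\<Sum>y\<in>S. \<Sum>x\<in>S. (\<integral>\<tau>. pA x (viewA \<tau>) * (pB y (viewB \<tau>) * ln (hB y \<tau>)) \<partial>T) / (?c * ln 2))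
      = (\<Sum>y\<in>S. DB y) / (card S * ln 2)"
      by (simp add: D_eq sum_divide_distrib mult.assoc cong: sum.cong)
    ultimately show ?thesis
      by (simp only: sum.distrib sum.swap[of "\<lambda>x y. (\<integral>\<tau>. pA x (viewA \<tau>) * (pB y (viewB \<tau>) * ln (hB y \<tau>)) \<partial>T) / (?c * ln 2)"])
  qed
  finally show ?thesis by (simp only: sum.distrib add_divide_distrib)
qed

text \<open>Markov's inequality: the inputs outside \<open>G\<close> contribute more than
  \<open>2 * L\<close> each, so they cannot be more than half of \<open>S\<close>. Halving the set
  of inputs is the origin of the \<open>ln 2\<close> subtracted from
  \<open>ln (card S)\<close>.\<close>

lemma leakage_lower_bound:
  assumes \<epsilon>: "0 \<le> \<epsilon>" "\<epsilon> < 1 / 2"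
  obtains L where "0 \<le> L" "(1 / 2 - \<epsilon>)\<^sup>2 * (ln (card S) - ln 2 - 2) \<le> (2 * L + 1)\<^sup>2"
    "ereal (L / ln 2) \<le> information_leakage S S P"
proof -
  define L where "L = (\<Sum>x\<in>S. DA x + DB x) / card S"
  have L0: "0 \<le> L"
    unfolding L_def by (intro divide_nonneg_nonneg sum_nonneg add_nonneg_nonneg D_nonneg) auto
  define G where "G = {x\<in>S. DA x + DB x \<le> 2 * L}"
  have GS: "G \<subseteq> S" and finG: "finite G" using finite_S by (auto simp: G_def)
  have half: "card S / 2 \<le> card G"
  proof (rule ccontr)
    assume "\<not> card S / 2 \<le> card G"
    moreover have "card (S - G) = card S - card G" "card G \<le> card S"
      using GS finite_S by (auto simp: card_Diff_subset finite_subset card_mono)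
    ultimately have c: "card S / 2 < card (S - G)" by simp
    then have ne: "S - G \<noteq> {}" using card_S by (intro notI) simp
    have "card S * L = 2 * L * (card S / 2)" by simp
    also have "\<dots> \<le> 2 * L * card (S - G)" using c L0 by (intro mult_left_mono) auto
    also have "\<dots> = (\<Sum>x\<in>S - G. 2 * L)" by simp
    also have "\<dots> < (\<Sum>x\<in>S - G. DA x + DB x)"
      using ne finite_S by (intro sum_strict_mono) (auto simp: G_def)
    also have "\<dots> \<le> (\<Sum>x\<in>S. DA x + DB x)"
      using finite_S D_nonneg by (intro sum_mono2) auto
    also have "\<dots> = card S * L" using card_S by (simp add: L_def)
    finally show False by simp
  qed
  then have G0: "0 < real (card G)" using card_S by linarith
  have "(1 / 2 - \<epsilon>)\<^sup>2 * (ln (card G) - 2) \<le> (2 * L + 1)\<^sup>2"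
  \<comment> \<open>\<open>M\<close> serves as reference law for both players, read through
    \<open>viewA\<close> in one argument of \<open>W\<close> and through \<open>viewB\<close> in the
    other. Since \<open>DA x\<close> and \<open>DB x\<close> are nonnegative with sum at most
    \<open>2 * L\<close> on \<open>G\<close>, each is at most \<open>D = 2 * L\<close>.\<close>
  proof (rule decoding_bound_quadratic[where M=M and N=M and G=G and h=hA and k=hB and K="card S"
        and W="\<lambda>\<tau> \<tau>'. accept (viewA \<tau>) (viewB \<tau>')" and \<epsilon>=\<epsilon>])
    have "(\<lambda>p. (viewA (fst p), viewB (snd p))) \<in> M \<Otimes>\<^sub>M M \<rightarrow>\<^sub>M NA \<Otimes>\<^sub>M NB" by measurable
    from measurable_compose[OF this measurable_accept]
    show "(\<lambda>(\<tau>, \<tau>'). accept (viewA \<tau>) (viewB \<tau>')) \<in> borel_measurable (M \<Otimes>\<^sub>M M)"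
      by (simp add: split_beta')
    show "G \<noteq> {}" using G0 by auto
    fix x assume x: "x \<in> G"
    then have xS: "x \<in> S" using GS by auto
    note xS[measurable]
    show "hA x \<in> borel_measurable M" "hB x \<in> borel_measurable M" by measurable
    show "(\<integral>\<tau>. hA x \<tau> \<partial>M) = 1" "(\<integral>\<tau>. hB x \<tau> \<partial>M) = 1" using xS by (simp_all add: integral_h)
    have "DA x + DB x \<le> 2 * L" using x by (simp add: G_def)
    then show "(\<integral>\<tau>. hA x \<tau> * ln (hA x \<tau>) \<partial>M) \<le> 2 * L" "(\<integral>\<tau>. hB x \<tau> * ln (hB x \<tau>) \<partial>M) \<le> 2 * L"
      using D_nonneg[OF xS] by (simp_all add: DA_def DB_def)
  qed (use GS \<epsilon> in \<open>auto intro!: prob_space_M accept_bounds finG h_bounds accept_correct accept_incorrect\<close>)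
  moreover have "ln (card S) - ln 2 \<le> ln (card G)"
    using ln_mono[of "card S / 2" "card G"] half card_S G0 by (simp add: ln_div)
  ultimately have "(1 / 2 - \<epsilon>)\<^sup>2 * (ln (card S) - ln 2 - 2) \<le> (2 * L + 1)\<^sup>2"
    by (elim order_trans[rotated]) (intro mult_left_mono, auto)
  moreover have "ereal (L / ln 2) \<le> information_leakage S S P"
    unfolding information_leakage_def L_def
    using information_leakage_uniform by (intro SUP_upper2[OF input_distribution]) simp
  ultimately show thesis using L0 that by blast
qed

end

theorem theorem2:
  fixes n :: nat and \<epsilon> \<delta>\<^sub>1 \<delta>\<^sub>2 :: real
  assumes "\<epsilon> \<ge> 0" and "\<delta>\<^sub>1 > 0" and "\<delta>\<^sub>2 > 0" and "\<epsilon> + \<delta>\<^sub>1 + \<delta>\<^sub>2 < 1 / 2"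
  shows "IL TYPE('r) TYPE('m) (bitstrings n) (bitstrings n) EQ_fn \<epsilon> \<ge>
    ereal (\<delta>\<^sub>1 * (2 * sqrt (g3 (\<epsilon> + \<delta>\<^sub>1 + \<delta>\<^sub>2)) * sqrt (real n)
                  - g3 (\<epsilon> + \<delta>\<^sub>1 + \<delta>\<^sub>2) - g2 (real n) (real n) \<delta>\<^sub>2 - 10)
           - 2 * g1 (2 * real n))"
  unfolding IL_def
\<comment> \<open>The bound is shown for every protocol. If the types admit none, the infimum is
  infinite and the claim still holds.\<close>
proof (rule INF_greatest)
  fix P :: "(bool list, bool list, bool, 'r, 'm) smp_protocol"
  assume P: "P \<in> {P. smp_protocol_on (bitstrings n) (bitstrings n) P \<and>
    computes_with_error (bitstrings n) (bitstrings n) P EQ_fn \<epsilon>}"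
  have card: "card (bitstrings n) = 2 ^ n" and fin: "finite (bitstrings n)"
    using card_lists_length_eq[of "UNIV :: bool set" n] finite_lists_length_eq[of "UNIV :: bool set" n]
    by (simp_all add: bitstrings_def)
  have EQ: "EQ_fn = (=)" by (intro ext) (simp add: EQ_fn_def)
  interpret equality_protocol P "bitstrings n" \<epsilon>
    using P fin card by unfold_locales (auto simp: EQ)
  have "\<epsilon> < 1 / 2" using assms by simp
  then obtain L where L: "0 \<le> L"
      "(1 / 2 - \<epsilon>)\<^sup>2 * (ln (card (bitstrings n)) - ln 2 - 2) \<le> (2 * L + 1)\<^sup>2"
      "ereal (L / ln 2) \<le> information_leakage (bitstrings n) (bitstrings n) P"
    using leakage_lower_bound assms(1) by blast
  have "ln (card (bitstrings n)) - ln 2 - 2 = (real n - 1) * ln 2 - 2"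
    by (simp add: card ln_realpow left_diff_distrib)
  with L(2) have "(1 / 2 - \<epsilon>)\<^sup>2 * ((real n - 1) * ln 2 - 2) \<le> (2 * L + 1)\<^sup>2" by simp
  from leakage_numeric_bound[OF assms L(1) this]
  show "ereal (\<delta>\<^sub>1 * (2 * sqrt (g3 (\<epsilon> + \<delta>\<^sub>1 + \<delta>\<^sub>2)) * sqrt (real n)
                  - g3 (\<epsilon> + \<delta>\<^sub>1 + \<delta>\<^sub>2) - g2 (real n) (real n) \<delta>\<^sub>2 - 10)
           - 2 * g1 (2 * real n)) \<le> information_leakage (bitstrings n) (bitstrings n) P"
    by (intro order_trans[OF _ L(3)]) simp
qed

end
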